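(* For all integers $k,k'\ge 0$, $\ell_1,\ldots,\ell_k,\ell'_1,\ldots,\ell'_{k'}\ge 1$ and $m\ge 0$, in the game $\mathbf{0.33}$, \[\mathcal{G}\bigl(S_{\ell_1,\ldots,\ell_k} \overset{m}{-} S_{\ell'_1,\ldots,\ell'_{k'}}\bigr)=\mathcal{G}\bigl(S_{\ell_1\bmod 3,\ldots,\ell_k\bmod 3} \overset{m \bmod 3}{-} S_{\ell'_1\bmod 3,\ldots,\ell'_{k'}\bmod 3}\bigr).\]
   Context: The game $\mathbf{0.33}$ on a finite graph $G$: players alternate; a move chooses a set $X$ of one vertex or of two adjacent vertices of $G$, lying in a connected component $H$ of $G$, such that $H-X$ is empty or connected, and deletes $X$. A player unable to move loses (normal play). Grundy value: $\mathcal{G}(G)=\mathrm{mex}\{\mathcal{G}(G'): G' \text{ reachable in one move}\}$, with $\mathrm{mex}(A)$ the least nonnegative integer not in $A$. Subdivided star $S_{\ell_1,\ldots,\ell_k}$ ($k\ge0$): a central vertex $c$ together with $k$ vertex-disjoint paths having $\ell_1,\ldots,\ell_k$ vertices, each with one endpoint adjacent to $c$ (a single vertex if $k=0$); an index equal to $0$ means no path is attached (it is omitted). Subdivided bistar: for subdivided stars $S,S'$ with central vertices $c,c'$ and an integer $m\ge1$, $S\overset{m}{-}S'$ is obtained from the disjoint union of $S$ and $S'$ by adding $m-1$ new vertices $v_1,\ldots,v_{m-1}$ and the edges of the path $c,v_1,\ldots,v_{m-1},c'$ (which has $m$ edges); $S\overset{0}{-}S'$ is obtained from the disjoint union by identifying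 $c$ and $c'$ (a subdivided star). *)

theory Defs
  imports "Graph_Theory.Digraph_Component"
begin

text \<open>A finite simple graph is a symmetric, loop-free, finite digraph
  (\<^locale>\<open>pair_graph\<close>, \<^locale>\<open>graph\<close>); an undirected edge is a pair of opposite arcs.\<close>

definition mex :: "nat set \<Rightarrow> nat" where
  "mex A = (LEAST n. n \<notin> A)"

text \<open>The connected components of \<open>G\<close> are its maximal connected subgraphs. Note that
  \<^const>\<open>connected\<close> excludes the graph without vertices.\<close>

definition moves_033 :: "('a, 'b) pre_digraph \<Rightarrow> ('a, 'b) pre_digraph set" where
  "moves_033 G = {G \<restriction> (verts G - X) | X H.
     pre_digraph.max_subgraph G connected H \<and> X \<subseteq> verts H \<and>
     ((\<exists>u. X = {u}) \<or> (\<exists>u v. u \<rightarrow>\<^bsub>G\<^esub> v \<and> X = {u, v})) \<and>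
     (verts H - X = {} \<or> connected (H \<restriction> (verts H - X)))}"

lemma moves_033_card_less:
  assumes "finite (verts G)" "G' \<in> moves_033 G"
  shows "card (verts G') < card (verts G)"
proof -
  obtain X H where X: "G' = G \<restriction> (verts G - X)" "X \<subseteq> verts H" "X \<noteq> {}"
    and H: "pre_digraph.max_subgraph G connected H"
    using assms(2) unfolding moves_033_def by auto
  have "verts H \<subseteq> verts G"
    using H by (auto simp: pre_digraph.max_subgraph_def subgraph_def)
  with X have "verts G' \<subset> verts G"
    by auto
  with assms(1) show ?thesis
    by (rule psubset_card_mono)
qed

text \<open>The value on infinite graphs is a dummy.\<close>

function grundy_033 :: "('a, 'b) pre_digraph \<Rightarrow> nat" where
  "grundy_033 G =
     (if finite (verts G) then mex (grundy_033 ` moves_033 G) else 0)"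
  by auto
termination
  by (relation "measure (\<lambda>G. card (verts G))") (auto intro: moves_033_card_less)

declare grundy_033.simps [simp del]

text \<open>\<open>Arm i j\<close> is the vertex of the \<open>i\<close>-th attached path at distance \<open>j \<ge> 1\<close> from the centre;
  an index \<open>0\<close> in the list contributes no vertex.\<close>

datatype star_vertex = Centre | Arm nat nat

definition subdivided_star :: "nat list \<Rightarrow> star_vertex pair_pre_digraph" where
  "subdivided_star ls = mk_symmetric (with_proj
     \<lparr> pverts = {Centre} \<union> {Arm i j | i j. i < length ls \<and> 1 \<le> j \<and> j \<le> ls ! i},
       parcs = {(Centre, Arm i 1) | i. i < length ls \<and> 1 \<le> ls ! i}
             \<union> {(Arm i j, Arm i (j + 1)) | i j. i < length ls \<and> 1 \<le> j \<and> j + 1 \<le> ls ! i} \<rparr>)"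

datatype bistar_vertex = LeftStar star_vertex | Link nat | RightStar star_vertex

text \<open>The map \<open>r\<close> embeds \<open>S'\<close>, identifying its centre with that of \<open>S\<close> if \<open>m = 0\<close>;
  \<open>p 0, \<dots>, p m\<close> is the path with \<open>m\<close> edges joining the two centres, its inner vertices
  being \<open>Link 1, \<dots>, Link (m - 1)\<close>.\<close>

definition subdivided_bistar ::
  "star_vertex pair_pre_digraph \<Rightarrow> nat \<Rightarrow> star_vertex pair_pre_digraph
     \<Rightarrow> bistar_vertex pair_pre_digraph" where
  "subdivided_bistar S m S' =
     (let r = (\<lambda>v. if m = 0 \<and> v = Centre then LeftStar Centre else RightStar v);
          p = (\<lambda>i. if i = 0 then LeftStar Centre
                   else if i < m then Link i else RightStar Centre)
      in mk_symmetric (with_proj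
        \<lparr> pverts = LeftStar ` pverts S \<union> r ` pverts S' \<union> Link ` {1..<m},
          parcs = map_prod LeftStar LeftStar ` parcs S \<union> map_prod r r ` parcs S'
                \<union> {(p i, p (i + 1)) | i. i < m} \<rparr>))"

end

theory Submission
  imports Defs "HOL-Library.Multiset"
begin

text \<open>
  If a centre carries at least three branches, it cannot be deleted, so the only moves shorten an
  arm by one or two vertices; all remaining positions are stars or paths. The Grundy values thus
  satisfy a recursion on multisets of arm lengths. Passing to residues modulo \<open>3\<close> identifies
  every option with an option of the reduced position or with a position from which the reduced
  position can be reached again, and the latter never has the value of the reduced position. What
  remains is the case where the reduced position degenerates to a star although the original one
  is a proper bistar: there the missing moves are supplied by raising a residue \<open>0\<close> to \<open>1\<close> or \<open>2\<close>.
  The critical instance is the star with two arms of length \<open>1\<close>, linked by an edge to a star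
  \<open>S\<close>, which has the same value as \<open>S\<close>.
\<close>


subsection \<open>Values of stars\<close>

text \<open>The obstacle is the link. While both centres of a proper bistar keep at least two arms,
  neither centre nor link can be touched. Once reduction leaves at most one nonzero residue
  \<open>a\<close> at a centre, that centre and the link become an arm of length
  \<open>a + m\<close> of a star, and the shortenings of this arm need counterparts among the
  original moves. Modulo 3 they lead to \<open>a + m + 1\<close> and \<open>a + m + 2\<close>.
  Lowering \<open>a\<close> yields the lengths from \<open>m\<close> to \<open>a + m - 1\<close>,
  which suffices for \<open>a = 2\<close>. For \<open>a = 1\<close> the length \<open>m - 1\<close>
  is missing. But reduction has then lost an arm of length divisible by 3, and raising its residue
  to 1 puts two arms of length 1 at the centre. If \<open>m = 1\<close>, the missing position is the
  other star itself, whence the critical instance. If \<open>m = 2\<close>, the arm has length 3 and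
  counts as absent, so it need not be moved. A second obstacle is that the centre of a path may be
  deletable. Arm moves alone still determine the value of a path, except for paths with one or two
  vertices; these need separate arguments.\<close>

lemma mex_notin: "finite A \<Longrightarrow> mex A \<notin> A"
  unfolding mex_def by (rule LeastI_ex) (rule ex_new_if_finite[OF infinite_UNIV_nat])

lemma less_mex_in: "k < mex A \<Longrightarrow> k \<in> A"
  unfolding mex_def using not_less_Least by blast

lemma mex_eqI:
  assumes "n \<notin> A" "\<And>k. k < n \<Longrightarrow> k \<in> A"
  shows "mex A = n"
  unfolding mex_def using assms by (intro Least_equality) (auto simp: not_less[symmetric])

definition nonzeros :: "nat multiset \<Rightarrow> nat" where
  "nonzeros M = size {#x \<in># M. x \<noteq> 0#}"

lemma nonzeros_add_mset [simp]:
  "nonzeros (add_mset x M) = (if x = 0 then nonzeros M else Suc (nonzeros M))"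
  by (simp add: nonzeros_def)

lemma nonzeros_empty [simp]: "nonzeros {#} = 0"
  by (simp add: nonzeros_def)

lemma nonzeros_union [simp]: "nonzeros (M + N) = nonzeros M + nonzeros N"
  by (simp add: nonzeros_def)

lemma nonzeros_le_sum: "nonzeros M \<le> \<Sum>\<^sub># M"
  by (induction M) auto

lemma sum_eq_0_if_nonzeros_eq_0: "nonzeros M = 0 \<Longrightarrow> \<Sum>\<^sub># M = 0"
  by (induction M) (auto split: if_splits)

definition arm_moves :: "nat multiset \<Rightarrow> nat multiset set" where
  "arm_moves M = {add_mset y N | x y N. M = add_mset x N \<and> y < x \<and> x \<le> y + 2}"

lemma arm_movesI: "y < x \<Longrightarrow> x \<le> y + 2 \<Longrightarrow> add_mset y N \<in> arm_moves (add_mset x N)"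
  unfolding arm_moves_def by blast

lemma arm_movesE:
  assumes "M' \<in> arm_moves M"
  obtains x y N where "M = add_mset x N" "M' = add_mset y N" "y < x" "x \<le> y + 2"
  using assms unfolding arm_moves_def by blast

lemma finite_arm_moves [simp]: "finite (arm_moves M)"
proof (rule finite_subset)
  show "arm_moves M \<subseteq> (\<lambda>(x, d). add_mset (x - d) (M - {#x#})) ` (set_mset M \<times> {1, 2})"
  proof
    fix M' assume "M' \<in> arm_moves M"
    then obtain x y N where *: "M = add_mset x N" "M' = add_mset y N" "y < x" "x \<le> y + 2"
      by (rule arm_movesE)
    then have "M' = (\<lambda>(x, d). add_mset (x - d) (M - {#x#})) (x, x - y)" "x - y \<in> {1, 2}"
      by auto
    with * show "M' \<in> (\<lambda>(x, d). add_mset (x - d) (M - {#x#})) ` (set_mset M \<times> {1, 2})"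
      by auto
  qed
qed auto

lemma arm_moves_sum:
  "M' \<in> arm_moves M \<Longrightarrow> \<Sum>\<^sub># M' < \<Sum>\<^sub># M \<and> \<Sum>\<^sub># M \<le> \<Sum>\<^sub># M' + 2"
  by (auto elim!: arm_movesE)

lemma arm_moves_nonzeros: "M' \<in> arm_moves M \<Longrightarrow> nonzeros M' \<le> nonzeros M"
  by (auto elim!: arm_movesE)

lemma arm_moves_add_mset:
  "arm_moves (add_mset x N) =
     {add_mset y N | y. y < x \<and> x \<le> y + 2} \<union> add_mset x ` arm_moves N"
proof (intro equalityI subsetI)
  fix M assume "M \<in> arm_moves (add_mset x N)"
  then obtain x' y N' where *: "add_mset x N = add_mset x' N'" "M = add_mset y N'" "y < x'" "x' \<le> y + 2"
    by (rule arm_movesE)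
  show "M \<in> {add_mset y N | y. y < x \<and> x \<le> y + 2} \<union> add_mset x ` arm_moves N"
  proof (cases "x = x'")
    case False
    with *(1) obtain K where "N = add_mset x' K" "N' = add_mset x K"
      by (auto simp: add_eq_conv_ex)
    then show ?thesis
      using * arm_movesI[of y x' K] by (auto simp: add_mset_commute image_iff)
  qed (use * in auto)
next
  fix M assume "M \<in> {add_mset y N | y. y < x \<and> x \<le> y + 2} \<union> add_mset x ` arm_moves N"
  then show "M \<in> arm_moves (add_mset x N)"
  proof
    assume "M \<in> add_mset x ` arm_moves N"
    then obtain z y K where "N = add_mset z K" "M = add_mset x (add_mset y K)" "y < z" "z \<le> y + 2"
      by (auto elim!: arm_movesE)
    then show ?thesis
      using arm_movesI[of y z "add_mset x K"] by (simp add: add_mset_commute)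
  qed (auto intro: arm_movesI)
qed

lemma arm_moves_union:
  "arm_moves (M + N) = (\<lambda>M'. M' + N) ` arm_moves M \<union> (\<lambda>N'. M + N') ` arm_moves N"
proof (induction M)
  case empty
  then show ?case by (auto simp: arm_moves_def)
next
  case (add x M)
  show ?case
    unfolding add_mset_add_single[symmetric] union_mset_add_mset_left arm_moves_add_mset add
    by (auto simp: image_Un image_image)
qed

text \<open>An entry \<open>0\<close> stands for an absent arm; a star with at most two arms is a path.\<close>

function star_value :: "nat multiset \<Rightarrow> nat" where
  "star_value M =
     (if nonzeros M \<le> 2 then (\<Sum>\<^sub># M + 1) mod 3 else mex (star_value ` arm_moves M))"
  by auto
termination
  by (relation "measure sum_mset") (auto dest: arm_moves_sum)

declare star_value.simps [simp del]

lemma star_value_path: "nonzeros M \<le> 2 \<Longrightarrow> star_value M = (\<Sum>\<^sub># M + 1) mod 3"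
  by (simp add: star_value.simps)

text \<open>In a path the total length drops by 1 or 2 and so changes modulo 3; otherwise the mex
  excludes the values of its options. The inequality is symmetric, so it also separates a position
  from those that can move to it, as the reversibility arguments require.\<close>

lemma star_value_arm_move_neq:
  assumes "M' \<in> arm_moves M"
  shows "star_value M' \<noteq> star_value M"
proof (cases "nonzeros M \<le> 2")
  case True
  with arm_moves_nonzeros[OF assms] arm_moves_sum[OF assms] show ?thesis
    by (simp add: star_value_path) presburger
next
  case False
  then have "star_value M = mex (star_value ` arm_moves M)"
    by (subst star_value.simps) simp
  then show ?thesis
    using mex_notin[of "star_value ` arm_moves M"] assms by (metis finite_arm_moves finite_imageI imageI)
qed

text \<open>For paths the second shortening is missing only if both arms have length 1, and then the
  value is 0, so no option is required. The bound excludes the paths with one and two vertices, of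
  values 1 and 2, for which arm moves give mex 0.\<close>

lemma star_value_mex:
  assumes "2 \<le> \<Sum>\<^sub># M"
  shows "star_value M = mex (star_value ` arm_moves M)"
proof (cases "nonzeros M \<le> 2")
  case True
  show ?thesis
  proof (rule mex_eqI[symmetric])
    show "star_value M \<notin> star_value ` arm_moves M"
      using star_value_arm_move_neq by force
    fix k assume k: "k < star_value M"
    have v: "star_value M = (\<Sum>\<^sub># M + 1) mod 3"
      using True by (rule star_value_path)
    have *: "(\<Sum>\<^sub># M + 1 - d) mod 3 \<in> star_value ` arm_moves M"
      if x: "x \<in># M" and d: "d \<le> x" "0 < d" "d \<le> 2" for x d
    proof -
      obtain N where N: "M = add_mset x N"
        using multi_member_split[OF x] by blast
      have "add_mset (x - d) N \<in> arm_moves M"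
        unfolding N using d by (intro arm_movesI) auto
      moreover have "star_value (add_mset (x - d) N) = (\<Sum>\<^sub># M + 1 - d) mod 3"
        using d True by (subst star_value_path) (auto simp: N Suc_diff_le split: if_splits)
      ultimately show ?thesis by force
    qed
    have "\<exists>x \<in># M. 0 < x"
      using assms by (metis not_less0 not_gr_zero sum_mset_0_iff zero_less_numeral leD)
    then have 1: "\<Sum>\<^sub># M mod 3 \<in> star_value ` arm_moves M"
      using *[of _ 1] by auto
    show "k \<in> star_value ` arm_moves M"
    proof (cases "\<exists>x \<in># M. 2 \<le> x")
      case True
      then have 2: "(\<Sum>\<^sub># M - 1) mod 3 \<in> star_value ` arm_moves M"
        using *[of _ 2] by auto
      have "k = \<Sum>\<^sub># M mod 3 \<or> k = (\<Sum>\<^sub># M - 1) mod 3"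
        using k assms unfolding v by (cases "\<Sum>\<^sub># M") (auto simp: mod_Suc split: if_splits)
      with 1 2 show ?thesis by auto
    next
      case False
      then have "\<Sum>\<^sub># M = nonzeros M"
        by (induction M) (auto simp: not_le less_2_cases_iff)
      with True assms k show ?thesis unfolding v by simp
    qed
  qed
next
  case False
  then show ?thesis by (subst star_value.simps) simp
qed

lemma star_value_zero: "star_value (add_mset 0 M) = star_value M"
proof (induction M rule: measure_induct_rule[of sum_mset])
  case (less M)
  have "arm_moves (add_mset 0 M) = add_mset 0 ` arm_moves M"
    by (auto simp: arm_moves_add_mset)
  moreover have "star_value ` add_mset 0 ` arm_moves M = star_value ` arm_moves M"
    unfolding image_image using less arm_moves_sum by (intro image_cong) auto
  ultimately show ?case
    by (subst (1 2) star_value.simps) simp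
qed

lemma star_value_add_zeros: "nonzeros N = 0 \<Longrightarrow> star_value (N + M) = star_value M"
  by (induction N) (auto simp: star_value_zero split: if_splits)

text \<open>Serves link lengths divisible by 3: the two centres are then identified, and the only
  arm of one side becomes an arm of the other star.\<close>

lemma star_value_merge: "nonzeros N \<le> 1 \<Longrightarrow> star_value (N + M) = star_value (add_mset (\<Sum>\<^sub># N) M)"
proof (induction N)
  case empty
  then show ?case by (simp add: star_value_zero)
next
  case (add x N)
  show ?case
  proof (cases "x = 0")
    case False
    with add have "nonzeros N = 0" by simp
    then show ?thesis
      using star_value_add_zeros[of N "add_mset x M"] sum_eq_0_if_nonzeros_eq_0[of N]
      by (simp del: sum_mset_0_iff)
  qed (use add in \<open>simp add: star_value_zero\<close>)
qed

text \<open>The moves of the longer arm that are not available on the shorter one are reversible: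
  from each of them the shorter position can be reached again.\<close>

lemma star_value_add_3: "star_value (add_mset (l + 3) M) = star_value (add_mset l M)"
proof (induction "l + \<Sum>\<^sub># M" arbitrary: l M rule: less_induct)
  case less
  show ?case
  proof (cases "l + \<Sum>\<^sub># M \<le> 1")
    \<comment> \<open>The shorter star has at most two vertices, so \<open>star_value_mex\<close>
      does not apply to it; both sides are paths whose lengths differ by 3.\<close>
    case True
    then have "nonzeros (add_mset l M) \<le> 1"
      using nonzeros_le_sum[of "add_mset l M"] by simp
    then show ?thesis
      by (auto simp: star_value_path split: if_splits) presburger+
  next
    case False
    have IH: "star_value (add_mset (y + 3) M) = star_value (add_mset y M)" if "y < l" for y
      using less that by simp
    have IH': "star_value (add_mset (l + 3) M') = star_value (add_mset l M')"
      if "M' \<in> arm_moves M" for M'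
      using less arm_moves_sum[OF that] by simp
    show ?thesis
    proof (subst star_value_mex, simp, rule mex_eqI)
      show "star_value (add_mset l M) \<notin> star_value ` arm_moves (add_mset (l + 3) M)"
      proof
        assume "star_value (add_mset l M) \<in> star_value ` arm_moves (add_mset (l + 3) M)"
        then consider y where "y < l + 3" "l + 3 \<le> y + 2" "star_value (add_mset l M) = star_value (add_mset y M)"
          | M' where "M' \<in> arm_moves M" "star_value (add_mset l M) = star_value (add_mset (l + 3) M')"
          by (auto simp: arm_moves_add_mset)
        then show False
        proof cases
          case 1
          then show ?thesis
            using star_value_arm_move_neq[OF arm_movesI[of l y M]] by auto
        next
          case 2
          then show ?thesis
            using star_value_arm_move_neq[of "add_mset l M'" "add_mset l M"] IH'[of M']
            by (auto simp: arm_moves_add_mset)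
        qed
      qed
    next
      fix k assume "k < star_value (add_mset l M)"
      then have "k \<in> star_value ` arm_moves (add_mset l M)"
        using False by (subst (asm) star_value_mex) (auto intro: less_mex_in)
      then consider y where "y < l" "l \<le> y + 2" "k = star_value (add_mset y M)"
          | M' where "M' \<in> arm_moves M" "k = star_value (add_mset l M')"
        by (auto simp: arm_moves_add_mset)
      then show "k \<in> star_value ` arm_moves (add_mset (l + 3) M)"
      proof cases
        case 1
        then show ?thesis using IH[of y]
          by (intro image_eqI[of _ _ "add_mset (y + 3) M"]) (auto intro: arm_movesI)
      next
        case 2
        then show ?thesis using IH'[of M']
          by (intro image_eqI[of _ _ "add_mset (l + 3) M'"]) (auto simp: arm_moves_add_mset)
      qed
    qed
  qed
qed

abbreviation residues :: "nat multiset \<Rightarrow> nat multiset" where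
  "residues \<equiv> image_mset (\<lambda>x. x mod 3)"

lemma star_value_mod_3: "star_value (add_mset (l mod 3) M) = star_value (add_mset l M)"
proof -
  have "star_value (add_mset (a + 3 * n) M) = star_value (add_mset a M)" for a n
  proof (induction n)
    case (Suc n)
    have "a + 3 * Suc n = (a + 3 * n) + 3" by simp
    then show ?case using Suc star_value_add_3 by metis
  qed simp
  from this[of "l mod 3" "l div 3"] show ?thesis by simp
qed

lemma star_value_cong:
  "l mod 3 = l' mod 3 \<Longrightarrow> star_value (add_mset l M) = star_value (add_mset l' M)"
  by (metis star_value_mod_3)

lemma star_value_residues: "star_value (residues M + N) = star_value (M + N)"
proof (induction M arbitrary: N)
  case (add x M)
  show ?case
    using add[of "add_mset x N"] star_value_mod_3[of x "residues M + N"] by simp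
qed simp

subsection \<open>Values of bistars\<close>

text \<open>With at most one arm at a centre, that centre, the \<open>m - 1\<close> inner link
  vertices and the arm together form a single arm at the other centre, whose length is the sum of
  the arms plus \<open>m\<close>.\<close>

function bistar_value :: "nat multiset \<Rightarrow> nat \<Rightarrow> nat multiset \<Rightarrow> nat" where
  "bistar_value A m B =
     (if m = 0 then star_value (A + B)
      else if nonzeros A \<le> 1 then star_value (add_mset (\<Sum>\<^sub># A + m) B)
      else if nonzeros B \<le> 1 then star_value (add_mset (\<Sum>\<^sub># B + m) A)
      else mex ((\<lambda>A'. bistar_value A' m B) ` arm_moves A \<union> (\<lambda>B'. bistar_value A m B') ` arm_moves B))"
  by auto
termination
  by (relation "measure (\<lambda>(A, m, B). \<Sum>\<^sub># A + \<Sum>\<^sub># B)") (auto dest: arm_moves_sum)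

declare bistar_value.simps [simp del]

lemma bistar_value_0: "bistar_value A 0 B = star_value (A + B)"
  by (simp add: bistar_value.simps)

lemma bistar_value_left:
  "0 < m \<Longrightarrow> nonzeros A \<le> 1 \<Longrightarrow> bistar_value A m B = star_value (add_mset (\<Sum>\<^sub># A + m) B)"
  by (simp add: bistar_value.simps)

text \<open>The two degenerate clauses overlap when neither centre has more than one arm; the bistar
  is then a path, and both clauses count the same vertices.\<close>

lemma bistar_value_right:
  assumes "0 < m" "nonzeros B \<le> 1"
  shows "bistar_value A m B = star_value (add_mset (\<Sum>\<^sub># B + m) A)"
proof (cases "nonzeros A \<le> 1")
  case True
  with assms show ?thesis
    by (simp add: bistar_value_left star_value_path ac_simps)
qed (use assms in \<open>simp add: bistar_value.simps\<close>)

definition bistar_option_values :: "nat multiset \<Rightarrow> nat \<Rightarrow> nat multiset \<Rightarrow> nat set" where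
  "bistar_option_values A m B =
     (\<lambda>A'. bistar_value A' m B) ` arm_moves A \<union> (\<lambda>B'. bistar_value A m B') ` arm_moves B"

lemma finite_bistar_option_values [simp]: "finite (bistar_option_values A m B)"
  by (simp add: bistar_option_values_def)

lemma bistar_value_mex:
  "0 < m \<Longrightarrow> 1 < nonzeros A \<Longrightarrow> 1 < nonzeros B \<Longrightarrow>
    bistar_value A m B = mex (bistar_option_values A m B)"
  by (subst bistar_value.simps) (simp add: bistar_option_values_def)

lemma bistar_value_commute: "bistar_value A m B = bistar_value B m A"
proof (induction "\<Sum>\<^sub># A + \<Sum>\<^sub># B" arbitrary: A B rule: less_induct)
  case less
  consider "m = 0" | "0 < m" "nonzeros A \<le> 1" | "0 < m" "nonzeros B \<le> 1"
    | "0 < m" "1 < nonzeros A" "1 < nonzeros B"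
    by linarith
  then show ?case
  proof cases
    case 4
    have "(\<lambda>A'. bistar_value A' m B) ` arm_moves A = (\<lambda>A'. bistar_value B m A') ` arm_moves A"
      "(\<lambda>B'. bistar_value A m B') ` arm_moves B = (\<lambda>B'. bistar_value B' m A) ` arm_moves B"
      using less arm_moves_sum by (auto intro!: image_cong)
    then have "bistar_option_values A m B = bistar_option_values B m A"
      unfolding bistar_option_values_def by auto
    with 4 show ?thesis by (simp add: bistar_value_mex)
  qed (simp_all add: bistar_value_0 bistar_value_left bistar_value_right union_commute)
qed

text \<open>In the degenerate cases an arm move of the bistar is an arm move of the star that it has
  become. These cases matter because the lemma is applied to reduced positions.\<close>

lemma bistar_value_left_move_neq:
  assumes "A' \<in> arm_moves A"
  shows "bistar_value A' m B \<noteq> bistar_value A m B"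
proof -
  consider "m = 0" | "0 < m" "nonzeros A \<le> 1" | "0 < m" "nonzeros B \<le> 1"
    | "0 < m" "1 < nonzeros A" "1 < nonzeros B"
    by linarith
  then show ?thesis
  proof cases
    case 1
    then show ?thesis
      using assms star_value_arm_move_neq[of "A' + B" "A + B"]
      by (auto simp: bistar_value_0 arm_moves_union)
  next
    case 2
    moreover have "add_mset (\<Sum>\<^sub># A' + m) B \<in> arm_moves (add_mset (\<Sum>\<^sub># A + m) B)"
      using arm_moves_sum[OF assms] by (intro arm_movesI) auto
    ultimately show ?thesis
      using star_value_arm_move_neq arm_moves_nonzeros[OF assms] by (simp add: bistar_value_left)
  next
    case 3
    moreover have "add_mset (\<Sum>\<^sub># B + m) A' \<in> arm_moves (add_mset (\<Sum>\<^sub># B + m) A)"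
      using assms by (simp add: arm_moves_add_mset)
    ultimately show ?thesis
      using star_value_arm_move_neq by (simp add: bistar_value_right)
  next
    case 4
    have "bistar_value A' m B \<in> bistar_option_values A m B"
      using assms by (simp add: bistar_option_values_def)
    with 4 show ?thesis
      using mex_notin[of "bistar_option_values A m B"] by (metis bistar_value_mex finite_bistar_option_values)
  qed
qed

text \<open>The hypothesis on \<open>nonzeros\<close> says that all entries are 0 or 1, so a move
  can only erase an arm.\<close>

lemma arm_moves_of_ones:
  assumes "nonzeros A = \<Sum>\<^sub># A" "A' \<in> arm_moves A"
  shows "\<Sum>\<^sub># A = Suc (\<Sum>\<^sub># A')" "nonzeros A' = \<Sum>\<^sub># A'"
proof -
  obtain x y N where *: "A = add_mset x N" "A' = add_mset y N" "y < x" "x \<le> y + 2"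
    using assms(2) by (rule arm_movesE)
  moreover have "nonzeros N \<le> \<Sum>\<^sub># N"
    by (rule nonzeros_le_sum)
  ultimately have "x = 1" "y = 0" "nonzeros N = \<Sum>\<^sub># N"
    using assms(1) by auto
  with * show "\<Sum>\<^sub># A = Suc (\<Sum>\<^sub># A')" "nonzeros A' = \<Sum>\<^sub># A'"
    by auto
qed

text \<open>By periodicity three values suffice. Without the third arm this is the path with three
  vertices, of value 0. With a third arm of length 1 all options have value 0. With length 2 the
  options are the two previous positions and a path with four vertices, of value 1.\<close>

lemma star_value_add_1_1:
  assumes A: "nonzeros A = 2" "\<Sum>\<^sub># A = 2"
  shows "star_value (add_mset l A) = l mod 3"
proof -
  have A': "nonzeros A' = 1" "\<Sum>\<^sub># A' = 1" if "A' \<in> arm_moves A" for A'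
    using arm_moves_of_ones[OF _ that] A by auto
  have path: "star_value (add_mset l A') = (l + 2) mod 3" if "A' \<in> arm_moves A" for A' l
    using A'[OF that] by (subst star_value_path) auto
  have 0: "star_value (add_mset 0 A) = 0"
    using A by (simp add: star_value_path)
  have 1: "star_value (add_mset 1 A) = 1"
  proof (subst star_value_mex)
    show "mex (star_value ` arm_moves (add_mset 1 A)) = 1"
      using 0 path[of _ 1] by (intro mex_eqI) (auto simp: arm_moves_add_mset image_iff)
  qed (use A in simp)
  have 2: "star_value (add_mset 2 A) = 2"
  proof (subst star_value_mex)
    show "mex (star_value ` arm_moves (add_mset 2 A)) = 2"
    proof (rule mex_eqI)
      have "star_value M \<noteq> 2" if M: "M \<in> arm_moves (add_mset 2 A)" for M
      proof -
        from M consider "M = add_mset 0 A" | "M = add_mset 1 A" | A' where "A' \<in> arm_moves A" "M = add_mset 2 A'"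
          by (auto simp: arm_moves_add_mset less_2_cases_iff)
        then show ?thesis using 0 1 path[of _ 2] by cases auto
      qed
      then show "2 \<notin> star_value ` arm_moves (add_mset 2 A)" by force
    next
      fix k :: nat assume "k < 2"
      then have "star_value (add_mset k A) = k" "add_mset k A \<in> arm_moves (add_mset 2 A)"
        using 0 1 by (auto simp: less_2_cases_iff intro: arm_movesI)
      then show "k \<in> star_value ` arm_moves (add_mset 2 A)" by force
    qed
  qed (use A in simp)
  have "l mod 3 = 0 \<or> l mod 3 = 1 \<or> l mod 3 = 2" by linarith
  then have "star_value (add_mset (l mod 3) A) = l mod 3"
    using 0 1 2 by metis
  then show ?thesis by (simp add: star_value_mod_3)
qed

text \<open>Moves in \<open>B\<close> match the moves of the star by induction. A move in
  \<open>A\<close> leaves an arm of length 2 at the centre of \<open>B\<close>; deleting that arm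
  gives \<open>B\<close> back, so this option cannot have the value of \<open>B\<close>. If
  \<open>B\<close> has at most one arm, the bistar is a star with arms 1, 1 and one further arm,
  whose value is known.\<close>

lemma bistar_value_1_1:
  assumes A: "nonzeros A = 2" "\<Sum>\<^sub># A = 2"
  shows "bistar_value A 1 B = star_value B"
proof (induction B rule: measure_induct_rule[of sum_mset])
  case (less B)
  have A': "bistar_value A' 1 B = star_value (add_mset 2 B)" if "A' \<in> arm_moves A" for A'
  proof -
    have "\<Sum>\<^sub># A' = 1" "nonzeros A' = 1"
      using arm_moves_of_ones[OF _ that] A by auto
    then show ?thesis by (simp add: bistar_value_left numeral_2_eq_2)
  qed
  show ?case
  proof (cases "nonzeros B \<le> 1")
    case True
    then show ?thesis
      using A by (simp add: bistar_value_right star_value_add_1_1 star_value_path)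
  next
    case False
    then have B: "2 \<le> \<Sum>\<^sub># B"
      using nonzeros_le_sum[of B] by simp
    have B': "bistar_value A 1 B' = star_value B'" if "B' \<in> arm_moves B" for B'
      using less arm_moves_sum[OF that] by simp
    have "star_value (add_mset 2 B) \<noteq> star_value (add_mset 0 B)"
      using star_value_arm_move_neq[OF arm_movesI[of 0 2 B]] by simp
    then have "star_value B \<notin> bistar_option_values A 1 B"
      using A' B' star_value_arm_move_neq[of _ B]
      unfolding bistar_option_values_def star_value_zero by fastforce
    moreover have "k \<in> bistar_option_values A 1 B" if "k < star_value B" for k
    proof -
      have "k \<in> star_value ` arm_moves B"
        using that less_mex_in unfolding star_value_mex[OF B] by blast
      with B' show ?thesis by (auto simp: bistar_option_values_def)
    qed
    ultimately show ?thesis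
      using A False by (subst bistar_value_mex) (auto intro: mex_eqI)
  qed
qed

subsection \<open>Reduction modulo 3\<close>

text \<open>Shortening by 1 or 2 reaches both other residues as soon as the arm has length at least
  3; a shorter arm reaches only the smaller ones.\<close>

lemma residue_move:
  assumes "(y::nat) < x mod 3 \<or> 3 \<le> x \<and> y < 3 \<and> y \<noteq> x mod 3"
  shows "\<exists>z<x. x \<le> z + 2 \<and> z mod 3 = y"
  using assms by presburger

lemma arm_moves_residues_lift:
  assumes "M \<in> arm_moves (residues A)"
  obtains A' where "A' \<in> arm_moves A" "residues A' = M"
proof -
  obtain r y N where M: "residues A = add_mset r N" "M = add_mset y N" "y < r"
    using assms by (rule arm_movesE)
  then obtain x K where A: "A = add_mset x K" "r = x mod 3" "N = residues K"
    using msed_map_invR by metis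
  obtain z where "z < x" "x \<le> z + 2" "z mod 3 = y"
    using residue_move[of y x] M A by auto
  then show thesis
    using M A by (intro that[of "add_mset z K"]) (auto intro: arm_movesI)
qed

text \<open>Reduction loses an arm exactly when its length is a positive multiple of 3; shortening
  it by 2 or 1 leaves the residue 1 or 2.\<close>

lemma raise_zero_residue:
  assumes "nonzeros (residues A) < nonzeros A"
  obtains N where "residues A = add_mset 0 N"
    "\<And>y. y \<in> {1, 2} \<Longrightarrow> \<exists>A' \<in> arm_moves A. residues A' = add_mset y N"
proof -
  have "\<exists>x \<in># A. x \<noteq> 0 \<and> x mod 3 = 0"
    using assms by (induction A) (auto split: if_splits)
  then obtain x where x: "x \<in># A" "x \<noteq> 0" "x mod 3 = 0"
    by auto
  obtain K where A: "A = add_mset x K"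
    using multi_member_split[OF x(1)] by blast
  show thesis
  proof (rule that[of "residues K"])
    show "residues A = add_mset 0 (residues K)"
      using A x by simp
    have "3 \<le> x"
      using x by presburger
    fix y :: nat assume "y \<in> {1, 2}"
    then obtain z where "z < x" "x \<le> z + 2" "z mod 3 = y"
      using residue_move[of y x] x \<open>3 \<le> x\<close> by auto
    then show "\<exists>A' \<in> arm_moves A. residues A' = add_mset y (residues K)"
      unfolding A by (intro bexI[of _ "add_mset z K"]) (auto intro: arm_movesI)
  qed
qed

text \<open>The arm is first lengthened to \<open>l + 3\<close>, so that its shortenings are always
  \<open>l + 2\<close> and \<open>l + 1\<close>, however small \<open>l\<close> is, and the star is
  large enough for \<open>star_value_mex\<close>.\<close>

lemma star_value_coverI:
  assumes "k < star_value (add_mset l N)"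
    and "star_value (add_mset (l + 1) N) \<in> S" "star_value (add_mset (l + 2) N) \<in> S"
    and "\<And>N'. N' \<in> arm_moves N \<Longrightarrow> star_value (add_mset l N') \<in> S"
  shows "k \<in> S"
proof -
  have "k < mex (star_value ` arm_moves (add_mset (l + 3) N))"
    using assms(1) star_value_add_3[of l N] by (subst star_value_mex[symmetric]) simp_all
  then have "k \<in> star_value ` arm_moves (add_mset (l + 3) N)"
    by (rule less_mex_in)
  then consider y where "y < l + 3" "l + 3 \<le> y + 2" "k = star_value (add_mset y N)"
    | N' where "N' \<in> arm_moves N" "k = star_value (add_mset (l + 3) N')"
    by (auto simp: arm_moves_add_mset)
  then show ?thesis
  proof cases
    case 1
    then have "y = l + 1 \<or> y = l + 2" by linarith
    with 1 assms show ?thesis by auto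
  next
    case 2
    then show ?thesis using assms(4) by (simp add: star_value_add_3)
  qed
qed

text \<open>The moves are those of the unreduced bistar and only their results are reduced: by the
  induction hypothesis of \<open>bistar_value_residues\<close> these are the values of its
  options.\<close>

definition residue_option_values :: "nat multiset \<Rightarrow> nat \<Rightarrow> nat multiset \<Rightarrow> nat set" where
  "residue_option_values A m B =
     (\<lambda>A'. bistar_value (residues A') m (residues B)) ` arm_moves A \<union>
     (\<lambda>B'. bistar_value (residues A) m (residues B')) ` arm_moves B"

lemma residue_option_values_commute: "residue_option_values A m B = residue_option_values B m A"
  unfolding residue_option_values_def by (auto simp: bistar_value_commute)

lemma residue_option_valuesI1:
  "A' \<in> arm_moves A \<Longrightarrow> bistar_value (residues A') m (residues B) \<in> residue_option_values A m B"
  unfolding residue_option_values_def by blast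

lemma residue_option_values_lift1:
  "M \<in> arm_moves (residues A) \<Longrightarrow> bistar_value M m (residues B) \<in> residue_option_values A m B"
  by (metis arm_moves_residues_lift residue_option_valuesI1)

lemma residue_option_values_lift2:
  "M \<in> arm_moves (residues B) \<Longrightarrow> bistar_value (residues A) m M \<in> residue_option_values A m B"
  by (metis residue_option_values_lift1 residue_option_values_commute bistar_value_commute)

text \<open>The reduced left side is a bare centre, that is, an arm of length \<open>m\<close> on
  the right star. Raising a lost residue yields the lengths \<open>m + 1\<close> and
  \<open>m + 2\<close>, exactly what \<open>star_value_coverI\<close> asks for.\<close>

lemma residue_options_cover_zeros:
  assumes "1 < nonzeros A" "0 < m" "nonzeros (residues A) = 0"
    and "k < bistar_value (residues A) m (residues B)"
  shows "k \<in> residue_option_values A m B"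
proof -
  obtain N where N: "residues A = add_mset 0 N"
    "\<And>y. y \<in> {1, 2} \<Longrightarrow> \<exists>A' \<in> arm_moves A. residues A' = add_mset y N"
    using raise_zero_residue[of A] assms by auto
  have N0: "nonzeros N = 0" "\<Sum>\<^sub># N = 0"
    using N(1) assms(3) sum_eq_0_if_nonzeros_eq_0[of N] by auto
  have val: "star_value (add_mset (m + y) (residues B)) \<in> residue_option_values A m B" if "y \<in> {1, 2}" for y
  proof -
    obtain A' where A': "A' \<in> arm_moves A" "residues A' = add_mset y N"
      using N(2) \<open>y \<in> {1, 2}\<close> by blast
    then have "bistar_value (residues A') m (residues B) = star_value (add_mset (m + y) (residues B))"
      using assms N0 by (subst bistar_value_left) (auto simp: add.commute simp del: sum_mset_0_iff)
    with residue_option_valuesI1[OF A'(1)] show ?thesis by metis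
  qed
  have l: "bistar_value (residues A) m M = star_value (add_mset m M)" for M
    using assms sum_eq_0_if_nonzeros_eq_0[of "residues A"]
    by (subst bistar_value_left) (auto simp del: sum_mset_0_iff)
  show ?thesis
  proof (rule star_value_coverI)
    show "k < star_value (add_mset m (residues B))"
      using assms l by simp
    fix M assume "M \<in> arm_moves (residues B)"
    then show "star_value (add_mset m M) \<in> residue_option_values A m B"
      using l residue_option_values_lift2 by metis
  qed (use val[of 1] val[of 2] in auto)
qed

text \<open>What remains is one nonzero residue \<open>a\<close> at the left centre. The values with
  the merged arm at \<open>a + m + 1\<close> and \<open>a + m + 2\<close> must be found among the
  options, or be shown to be dispensable.\<close>

lemma residue_options_cover_left:
  assumes A: "1 < nonzeros A" and B: "1 < nonzeros B" and m: "0 < m" "m < 3"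
    and A1: "nonzeros (residues A) \<le> 1"
    and k: "k < bistar_value (residues A) m (residues B)"
  shows "k \<in> residue_option_values A m B"
proof (cases "nonzeros (residues A) = 0 \<or> nonzeros (residues B) = 0")
  case True
  then show ?thesis
    using residue_options_cover_zeros A B m k
    by (metis bistar_value_commute residue_option_values_commute)
next
  case False
  let ?S = "residue_option_values A m B"
  let ?B = "residues B"
  obtain a where a: "a \<in># residues A" "a \<noteq> 0"
    using False by (auto simp: nonzeros_def)
  obtain Z where Z: "residues A = add_mset a Z"
    using multi_member_split[OF a(1)] by blast
  have Z0: "nonzeros Z = 0" "\<Sum>\<^sub># Z = 0"
    using Z a A1 sum_eq_0_if_nonzeros_eq_0[of Z] by auto
  have "a = 1 \<or> a = 2"
    using a by auto
  have l: "bistar_value (add_mset x Z) m M = star_value (add_mset (x + m) M)" for x M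
    using m Z0 by (subst bistar_value_left) (auto simp del: sum_mset_0_iff)
  have k': "k < star_value (add_mset (a + m) ?B)"
    using k l Z by simp
  have lower: "star_value (add_mset (x + m) ?B) \<in> ?S" if "x < a" for x
  proof -
    have "add_mset x Z \<in> arm_moves (residues A)"
      unfolding Z using that \<open>a = 1 \<or> a = 2\<close> by (intro arm_movesI) auto
    from residue_option_values_lift1[OF this, of m B] show ?thesis by (simp add: l)
  qed
  have moveB: "star_value (add_mset (a + m) M) \<in> ?S" if "M \<in> arm_moves ?B" for M
    using residue_option_values_lift2[OF that, of A m] by (simp add: Z l)
  obtain N where N: "residues A = add_mset 0 N"
    "\<And>y. y \<in> {1, 2} \<Longrightarrow> \<exists>A' \<in> arm_moves A. residues A' = add_mset y N"
    using raise_zero_residue[of A] A A1 by auto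
  have Na: "nonzeros N = 1" "\<Sum>\<^sub># N = a"
  proof -
    have "nonzeros (residues A) = 1" "\<Sum>\<^sub># (residues A) = a"
      using Z0 a(2) unfolding Z by (auto simp del: sum_mset_0_iff)
    then show "nonzeros N = 1" "\<Sum>\<^sub># N = a" unfolding N(1) by auto
  qed
  \<comment> \<open>For \<open>a = 1\<close> this is the position whose left centre carries two arms
    of length 1.\<close>
  have raise: "bistar_value (add_mset 1 N) m ?B \<in> ?S"
    using N(2)[of 1] residue_option_valuesI1 by (metis insertI1)
  consider "a = 2" | "a = 1" "m = 1" | "a = 1" "m = 2"
    using m \<open>a = 1 \<or> a = 2\<close> by linarith
  then show ?thesis
  proof cases
    case 1
    \<comment> \<open>Both lengths are congruent to the results of lowering the residue 2, to 0 and
      to 1.\<close>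
    have "(a + m + 1) mod 3 = (0 + m) mod 3" "(a + m + 2) mod 3 = (1 + m) mod 3"
      using 1 by presburger+
    then have "star_value (add_mset (a + m + 1) ?B) \<in> ?S" "star_value (add_mset (a + m + 2) ?B) \<in> ?S"
      using lower[of 0] lower[of 1] 1 by (metis star_value_cong zero_less_numeral one_less_numeral_iff semiring_norm(76))+
    from star_value_coverI[OF k' this moveB] show ?thesis .
  next
    case 2
    \<comment> \<open>Here \<open>a + m + 1 = 3\<close>: the arm vanishes modulo 3, leaving the
      right star alone, and the critical instance provides its value.\<close>
    have "star_value (add_mset (a + m + 1) ?B) \<in> ?S"
    proof -
      have "star_value (add_mset (a + m + 1) ?B) = star_value ?B"
        using star_value_cong[of "a + m + 1" 0 ?B] 2 by (simp add: star_value_zero)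
      also have "\<dots> = bistar_value (add_mset 1 N) m ?B"
        using Na 2 bistar_value_1_1[of "add_mset 1 N" ?B] by simp
      finally show ?thesis using raise by simp
    qed
    moreover have "star_value (add_mset (a + m + 2) ?B) \<in> ?S"
      using lower[of 0] star_value_cong[of "a + m + 2" "0 + m" ?B] 2 by simp
    ultimately show ?thesis
      using star_value_coverI[OF k' _ _ moveB] by simp
  next
    case 3
    \<comment> \<open>Since \<open>a + m = 3\<close>, the merged arm counts as absent, and the moves
      in the right star suffice if that star is large enough.\<close>
    have sB: "star_value (add_mset (a + m) M) = star_value M" for M
      using star_value_cong[of "a + m" 0 M] 3 by (simp add: star_value_zero)
    show ?thesis
    proof (cases "2 \<le> \<Sum>\<^sub># ?B")
      case True
      then have "k < mex (star_value ` arm_moves ?B)"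
        using k' unfolding sB by (subst (asm) star_value_mex)
      then have "k \<in> star_value ` arm_moves ?B"
        by (rule less_mex_in)
      then show ?thesis
        using moveB by (auto simp: sB)
    next
      \<comment> \<open>The reduced right star is the path with two vertices, of value 2. Lowering
        \<open>a\<close> gives a path with four vertices, of value 1; raising the lost residue gives
        a star with arms 1, 1 and 3, of value 0.\<close>
      case False
      then have B1: "nonzeros ?B = 1" "\<Sum>\<^sub># ?B = 1"
        using nonzeros_le_sum[of ?B] \<open>\<not> (nonzeros (residues A) = 0 \<or> nonzeros ?B = 0)\<close> by linarith+
      have "star_value ?B = 2"
        using B1 by (simp add: star_value_path)
      then have "k = 0 \<or> k = 1"
        using k' sB[of ?B] by linarith
      moreover have "1 \<in> ?S"
        using lower[of 0] 3 B1 by (simp add: star_value_path)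
      moreover have "bistar_value (add_mset 1 N) m ?B = 0"
        using B1 Na 3 by (simp add: bistar_value_right star_value_add_1_1)
      then have "0 \<in> ?S"
        using raise by simp
      ultimately show ?thesis by auto
    qed
  qed
qed

lemma residue_options_cover:
  assumes A: "1 < nonzeros A" and B: "1 < nonzeros B" and m: "m < 3"
    and k: "k < bistar_value (residues A) m (residues B)"
  shows "k \<in> residue_option_values A m B"
proof -
  let ?S = "residue_option_values A m B"
  consider "m = 0" "2 \<le> \<Sum>\<^sub># (residues A + residues B)"
    | "m = 0" "\<Sum>\<^sub># (residues A + residues B) \<le> 1"
    | "0 < m" "nonzeros (residues A) \<le> 1" | "0 < m" "nonzeros (residues B) \<le> 1"
    | "0 < m" "1 < nonzeros (residues A)" "1 < nonzeros (residues B)"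
    by linarith
  then show ?thesis
  proof cases
    case 1
    then have "k < mex (star_value ` arm_moves (residues A + residues B))"
      using k star_value_mex[OF 1(2)] by (simp add: bistar_value_0)
    then have "k \<in> star_value ` arm_moves (residues A + residues B)"
      by (rule less_mex_in)
    then show ?thesis
      using residue_option_values_lift1[of _ A 0 B] residue_option_values_lift2[of _ B A 0] 1
      by (auto simp: arm_moves_union bistar_value_0)
  next
    \<comment> \<open>The reduced position is a path with \<open>s + 1\<close> vertices, at most
      two, whose value arm moves do not determine. Raising a lost residue by 1 or 2 gives paths in
      the other two classes modulo 3.\<close>
    case 2
    then have nz: "nonzeros (residues A) + nonzeros (residues B) \<le> 1"
      using nonzeros_le_sum[of "residues A + residues B"] by simp
    obtain N where N: "residues A = add_mset 0 N"
      "\<And>y. y \<in> {1, 2} \<Longrightarrow> \<exists>A' \<in> arm_moves A. residues A' = add_mset y N"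
      using raise_zero_residue[of A] A nz by auto
    define s where "s = \<Sum>\<^sub># N + \<Sum>\<^sub># (residues B)"
    have "(s + y + 1) mod 3 \<in> ?S" if "y \<in> {1, 2}" for y
    proof -
      obtain A' where A': "A' \<in> arm_moves A" "residues A' = add_mset y N"
        using N(2) \<open>y \<in> {1, 2}\<close> by blast
      have "bistar_value (residues A') m (residues B) = (s + y + 1) mod 3"
        using nz 2(1) N(1) A' by (simp add: bistar_value_0 star_value_path s_def ac_simps)
      with residue_option_valuesI1[OF A'(1)] show ?thesis by metis
    qed
    from this[of 1] this[of 2] have "(s + 1 + 1) mod 3 \<in> ?S" "(s + 2 + 1) mod 3 \<in> ?S"
      by blast+
    moreover have "k < (s + 1) mod 3"
      using k nz 2(1) N(1) by (simp add: bistar_value_0 star_value_path s_def)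
    then have "k = (s + 1 + 1) mod 3 \<or> k = (s + 2 + 1) mod 3"
      by (auto simp: mod_Suc split: if_splits)
    ultimately show ?thesis by auto
  next
    case 3
    then show ?thesis using residue_options_cover_left A B m k by blast
  next
    case 4
    then show ?thesis
      using residue_options_cover_left A B m k
      by (metis bistar_value_commute residue_option_values_commute)
  next
    case 5
    then have "k \<in> bistar_option_values (residues A) m (residues B)"
      using k less_mex_in by (simp add: bistar_value_mex)
    then show ?thesis
      using residue_option_values_lift1 residue_option_values_lift2
      by (auto simp: bistar_option_values_def)
  qed
qed

text \<open>The two residues of the shortened arm differ, and distinct residues are at most 2 apart,
  so the larger can be moved to the smaller. Either direction keeps the value of the reduced
  position out of its mex set.\<close>

lemma residues_move_comparable:
  assumes "A' \<in> arm_moves A"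
  shows "residues A' \<in> arm_moves (residues A) \<or> residues A \<in> arm_moves (residues A')"
proof -
  obtain x y N where *: "A = add_mset x N" "A' = add_mset y N" "y < x" "x \<le> y + 2"
    using assms by (rule arm_movesE)
  then have "y mod 3 < x mod 3 \<or> x mod 3 < y mod 3"
    by presburger
  moreover have "x mod 3 \<le> y mod 3 + 2" "y mod 3 \<le> x mod 3 + 2"
    by presburger+
  ultimately show ?thesis
    unfolding * by (auto intro: arm_movesI)
qed

theorem bistar_value_residues:
  "bistar_value A m B = bistar_value (residues A) (m mod 3) (residues B)"
proof (induction "\<Sum>\<^sub># A + \<Sum>\<^sub># B" arbitrary: A B rule: less_induct)
  case less
  have sum_mod: "\<Sum>\<^sub># (residues A) mod 3 = \<Sum>\<^sub># A mod 3" for A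
    by (induction A) (auto simp: mod_simps, metis mod_add_right_eq mod_add_left_eq)
  have nz: "nonzeros (residues A) \<le> nonzeros A" for A
    by (induction A) auto
  \<comment> \<open>Both positions are stars here, and the length of the merged arm is preserved
    modulo 3. The claim is made for arbitrary \<open>A\<close> and \<open>B\<close> so that it can
    be used with the sides exchanged.\<close>
  have small: "bistar_value A m B = bistar_value (residues A) (m mod 3) (residues B)"
    if "0 < m" "nonzeros A \<le> 1" for A B
  proof -
    have "star_value (add_mset (\<Sum>\<^sub># A + m) B) = star_value (add_mset (\<Sum>\<^sub># A + m) (residues B))"
      using star_value_residues[of B "{#\<Sum>\<^sub># A + m#}"] by simp
    also have "\<dots> = star_value (add_mset (\<Sum>\<^sub># (residues A) + m mod 3) (residues B))"
      by (rule star_value_cong) (metis sum_mod mod_add_cong mod_mod_trivial)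
    also have "\<dots> = bistar_value (residues A) (m mod 3) (residues B)"
      using nz[of A] that
      by (cases "m mod 3 = 0") (simp_all add: bistar_value_0 star_value_merge bistar_value_left)
    finally show ?thesis
      using that by (simp add: bistar_value_left)
  qed
  consider "m = 0" | "0 < m" "nonzeros A \<le> 1" | "0 < m" "nonzeros B \<le> 1"
    | "0 < m" "1 < nonzeros A" "1 < nonzeros B"
    by linarith
  then show ?case
  proof cases
    case 1
    then show ?thesis
      using star_value_residues[of A B] star_value_residues[of B "residues A"]
      by (simp add: bistar_value_0 union_commute)
  next
    case 2
    then show ?thesis by (rule small)
  next
    case 3
    then show ?thesis using small by (metis bistar_value_commute)
  next
    case 4
    have "bistar_option_values A m B = residue_option_values A (m mod 3) B"
      unfolding bistar_option_values_def residue_option_values_def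
      using less arm_moves_sum by (intro arg_cong2[of _ _ _ _ "(\<union>)"] image_cong) auto
    moreover have "mex (residue_option_values A (m mod 3) B) = bistar_value (residues A) (m mod 3) (residues B)"
    proof (rule mex_eqI)
      have *: "bistar_value (residues A') r C \<noteq> bistar_value (residues A) r C"
        if "A' \<in> arm_moves A" for A' A C and r
        using residues_move_comparable[OF that] bistar_value_left_move_neq by metis
      have "bistar_value C r (residues B') \<noteq> bistar_value C r (residues B)"
        if "B' \<in> arm_moves B" for B' B C and r
        using *[OF that, of r C] by (simp add: bistar_value_commute[of C])
      with * show "bistar_value (residues A) (m mod 3) (residues B) \<notin> residue_option_values A (m mod 3) B"
        unfolding residue_option_values_def by (metis (no_types, lifting) UnE imageE)
    qed (use 4 residue_options_cover in auto)
    ultimately show ?thesis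
      using 4 by (simp add: bistar_value_mex)
  qed
qed

subsection \<open>The game on induced subgraphs\<close>

text \<open>All positions of a game live in one fixed, possibly infinite relation, so a position is
  determined by its vertex set.\<close>

definition induced_graph :: "'a rel \<Rightarrow> 'a set \<Rightarrow> ('a, 'a \<times> 'a) pre_digraph" where
  "induced_graph E V = with_proj \<lparr>pverts = V, parcs = E \<inter> V \<times> V\<rparr>"

definition induced_value :: "'a rel \<Rightarrow> 'a set \<Rightarrow> nat" where
  "induced_value E V = grundy_033 (induced_graph E V)"

definition connected_set :: "'a rel \<Rightarrow> 'a set \<Rightarrow> bool" where
  "connected_set E V \<longleftrightarrow> V \<noteq> {} \<and> (\<forall>x\<in>V. \<forall>y\<in>V. (x, y) \<in> (E \<inter> V \<times> V)\<^sup>*)"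

text \<open>No component is mentioned: this describes legal moves for connected \<open>V\<close>,
  whose only component is \<open>V\<close> itself.\<close>

definition removable :: "'a rel \<Rightarrow> 'a set \<Rightarrow> 'a set \<Rightarrow> bool" where
  "removable E V X \<longleftrightarrow> X \<subseteq> V \<and> ((\<exists>u. X = {u}) \<or> (\<exists>u v. (u, v) \<in> E \<and> X = {u, v})) \<and>
     (V - X = {} \<or> connected_set E (V - X))"

definition deletions :: "'a rel \<Rightarrow> 'a set \<Rightarrow> 'a set set" where
  "deletions E V = {V - X | X. removable E V X}"

lemma rtrancl_on_eq_rtrancl:
  assumes "x \<in> V"
  shows "(x, y) \<in> rtrancl_on V (E \<inter> V \<times> V) \<longleftrightarrow> (x, y) \<in> (E \<inter> V \<times> V)\<^sup>*"
proof
  assume "(x, y) \<in> rtrancl_on V (E \<inter> V \<times> V)"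
  then show "(x, y) \<in> (E \<inter> V \<times> V)\<^sup>*"
    by (induction rule: rtrancl_on_induct) (auto intro: rtrancl_into_rtrancl)
next
  assume "(x, y) \<in> (E \<inter> V \<times> V)\<^sup>*"
  then show "(x, y) \<in> rtrancl_on V (E \<inter> V \<times> V)"
    by (induction rule: rtrancl_induct) (auto simp: assms intro: rtrancl_on_into_rtrancl_on)
qed

lemma connected_induced_graph:
  assumes "sym E"
  shows "connected (induced_graph E V) \<longleftrightarrow> connected_set E V"
proof -
  have "parcs (mk_symmetric (induced_graph E V)) = E \<inter> V \<times> V"
    using assms by (auto simp: parcs_mk_symmetric induced_graph_def dest: symD)
  then show ?thesis
    by (auto simp: connected_def strongly_connected_def connected_set_def reachable_def
        rtrancl_on_eq_rtrancl induced_graph_def[of E V])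
qed

lemma induce_induced_graph:
  "W \<subseteq> V \<Longrightarrow> induced_graph E V \<restriction> W = induced_graph E W"
  by (auto simp: induced_graph_def induce_subgraph_def with_proj_def)

lemma wf_induced_graph: "wf_digraph (induced_graph E V)"
  by unfold_locales (auto simp: induced_graph_def)

text \<open>A connected graph is a connected subgraph of itself that contains all others; this
  eliminates the component from \<open>moves_033\<close>.\<close>

lemma max_subgraph_connected:
  assumes "wf_digraph G" "connected G"
  shows "pre_digraph.max_subgraph G connected H \<longleftrightarrow> H = G"
proof -
  have "subgraph G G"
    using assms by (auto simp: subgraph_def compatible_def)
  then show ?thesis
    using assms unfolding pre_digraph.max_subgraph_def
    by (auto dest: subgraph_trans) (metis subgraph_def subset_antisym compatible_def pre_digraph.equality old.unit.exhaust)
qed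

lemma moves_033_induced_graph:
  assumes "sym E" "connected_set E V"
  shows "moves_033 (induced_graph E V) = induced_graph E ` deletions E V"
proof -
  have sub: "pre_digraph.max_subgraph (induced_graph E V) connected H \<longleftrightarrow> H = induced_graph E V" for H
    using assms by (intro max_subgraph_connected) (auto simp: wf_induced_graph connected_induced_graph)
  have [simp]: "verts (induced_graph E W) = W" "arcs_ends (induced_graph E W) = E \<inter> W \<times> W" for W
    by (simp_all add: induced_graph_def)
  have "moves_033 (induced_graph E V) =
    {induced_graph E V \<restriction> (V - X) | X. X \<subseteq> V \<and>
     ((\<exists>u. X = {u}) \<or> (\<exists>u v. (u, v) \<in> E \<inter> V \<times> V \<and> X = {u, v})) \<and>
     (V - X = {} \<or> connected (induced_graph E V \<restriction> (V - X)))}"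
    unfolding moves_033_def sub by simp
  also have "\<dots> = {induced_graph E (V - X) | X. removable E V X}"
  proof -
    have "(\<exists>u v. (u, v) \<in> E \<inter> V \<times> V \<and> X = {u, v}) \<longleftrightarrow> (\<exists>u v. (u, v) \<in> E \<and> X = {u, v})"
      if "X \<subseteq> V" for X
      using that by auto
    then show ?thesis
      unfolding induce_induced_graph[OF Diff_subset] connected_induced_graph[OF assms(1)]
      by (intro Collect_cong ex_cong1) (simp add: removable_def cong: conj_cong)
  qed
  also have "\<dots> = induced_graph E ` deletions E V"
    unfolding deletions_def by (simp only: setcompr_eq_image image_image)
  finally show ?thesis .
qed

lemma induced_value_mex:
  assumes "sym E" "connected_set E V" "finite V"
  shows "induced_value E V = mex (induced_value E ` deletions E V)"
proof -
  have "induced_value E V = mex (grundy_033 ` moves_033 (induced_graph E V))"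
    unfolding induced_value_def using assms(3) by (subst grundy_033.simps) (simp add: induced_graph_def)
  then show ?thesis
    by (simp add: moves_033_induced_graph assms image_image induced_value_def)
qed

text \<open>Needed separately because a deletion may leave nothing, whereas
  \<open>connected_set\<close> excludes the empty set.\<close>

lemma induced_value_empty: "induced_value E {} = 0"
proof -
  have "moves_033 (induced_graph E {}) = {}"
    by (auto simp: moves_033_def pre_digraph.max_subgraph_def subgraph_def induced_graph_def)
  then show ?thesis
    unfolding induced_value_def
    by (subst grundy_033.simps) (auto simp: induced_graph_def mex_def)
qed

section \<open>Invariance of the values under isomorphism\<close>

lemma connected_set_image:
  assumes "connected_set E V" "\<And>x y. x \<in> V \<Longrightarrow> y \<in> V \<Longrightarrow> (x, y) \<in> E \<Longrightarrow> (f x, f y) \<in> E'"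
  shows "connected_set E' (f ` V)"
proof -
  have "(f x, f y) \<in> (E' \<inter> f ` V \<times> f ` V)\<^sup>*" if "(x, y) \<in> (E \<inter> V \<times> V)\<^sup>*" for x y
    using that
  proof (induction rule: rtrancl_induct)
    case (step y z)
    then have "(f y, f z) \<in> E' \<inter> f ` V \<times> f ` V"
      using assms(2) by blast
    with step.IH show ?case by (rule rtrancl_into_rtrancl)
  qed simp
  with assms(1) show ?thesis
    by (auto simp: connected_set_def)
qed

lemma connected_set_iso:
  assumes "inj_on f V" "\<And>x y. x \<in> V \<Longrightarrow> y \<in> V \<Longrightarrow> (f x, f y) \<in> E' \<longleftrightarrow> (x, y) \<in> E"
  shows "connected_set E' (f ` V) \<longleftrightarrow> connected_set E V"
proof
  assume "connected_set E' (f ` V)"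
  then have "connected_set E (the_inv_into V f ` f ` V)"
    by (rule connected_set_image) (auto simp: assms the_inv_into_f_f)
  moreover have "the_inv_into V f ` f ` V = V"
    using assms(1) by (auto simp: image_image the_inv_into_f_f)
  ultimately show "connected_set E V" by simp
qed (auto intro: connected_set_image simp: assms)

lemma deletions_iso:
  assumes inj: "inj_on f V" and f: "\<And>x y. x \<in> V \<Longrightarrow> y \<in> V \<Longrightarrow> (f x, f y) \<in> E' \<longleftrightarrow> (x, y) \<in> E"
  shows "deletions E' (f ` V) = image f ` deletions E V"
proof -
  have P: "removable E' (f ` V) (f ` X) \<longleftrightarrow> removable E V X" if "X \<subseteq> V" for X
  proof -
    have diff: "f ` V - f ` X = f ` (V - X)"
      using inj_on_image_set_diff[OF inj, of V X] that by auto
    have "connected_set E' (f ` (V - X)) \<longleftrightarrow> connected_set E (V - X)"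
      using f by (intro connected_set_iso inj_on_subset[OF inj]) auto
    moreover have "(\<exists>u. f ` X = {u}) \<longleftrightarrow> (\<exists>u. X = {u})"
      using card_image[OF inj_on_subset[OF inj that]] by (metis card_1_singletonE card_1_singleton_iff)
    moreover have "(\<exists>u v. (u, v) \<in> E' \<and> f ` X = {u, v}) \<longleftrightarrow> (\<exists>u v. (u, v) \<in> E \<and> X = {u, v})"
    proof
      assume "\<exists>u v. (u, v) \<in> E' \<and> f ` X = {u, v}"
      then obtain u v where uv: "(f u, f v) \<in> E'" "f ` X = {f u, f v}" "u \<in> X" "v \<in> X"
        by (metis imageE insertI1 insert_commute)
      then have "X = {u, v}"
        using inj_on_image_eq_iff[OF inj, of X "{u, v}"] that by auto
      moreover have "(u, v) \<in> E"
        using uv f[of u v] that by auto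
      ultimately show "\<exists>u v. (u, v) \<in> E \<and> X = {u, v}" by metis
    next
      assume "\<exists>u v. (u, v) \<in> E \<and> X = {u, v}"
      then obtain u v where "(u, v) \<in> E" "X = {u, v}" by metis
      with f[of u v] that have "(f u, f v) \<in> E'" "f ` X = {f u, f v}" by auto
      then show "\<exists>u v. (u, v) \<in> E' \<and> f ` X = {u, v}" by metis
    qed
    ultimately show ?thesis
      using that by (simp add: removable_def diff image_mono)
  qed
  have "{X'. removable E' (f ` V) X'} = image f ` {X. removable E V X}"
  proof (intro equalityI subsetI; clarify)
    fix X' assume *: "removable E' (f ` V) X'"
    then obtain X where "X \<subseteq> V" "X' = f ` X"
      by (auto simp: removable_def subset_image_iff)
    with P * show "X' \<in> image f ` {X. removable E V X}" by auto
  next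
    fix X assume "removable E V X"
    then show "removable E' (f ` V) (f ` X)"
      using P by (auto simp: removable_def)
  qed
  then have "deletions E' (f ` V) = (\<lambda>X. f ` V - f ` X) ` {X. removable E V X}"
    unfolding deletions_def setcompr_eq_image by (simp add: image_image)
  also have "\<dots> = (\<lambda>X. f ` (V - X)) ` {X. removable E V X}"
    using inj_on_image_set_diff[OF inj, of V] by (intro image_cong) (auto simp: removable_def)
  also have "\<dots> = image f ` deletions E V"
    unfolding deletions_def by (simp only: setcompr_eq_image image_image)
  finally show ?thesis .
qed

text \<open>The map has to respect edges only inside \<open>V\<close>, a condition inherited by
  subsets; every nonempty result of a deletion is again connected, so the induction applies to
  it.\<close>

lemma induced_value_iso:
  assumes "sym E" "sym E'" "finite V" "connected_set E V" "inj_on f V"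
    and "\<And>x y. x \<in> V \<Longrightarrow> y \<in> V \<Longrightarrow> (f x, f y) \<in> E' \<longleftrightarrow> (x, y) \<in> E"
  shows "induced_value E' (f ` V) = induced_value E V"
  using assms(3-)
proof (induction V rule: finite_psubset_induct)
  case (psubset V)
  have "induced_value E' (f ` W) = induced_value E W" if "W \<in> deletions E V" for W
  proof (cases "W = {}")
    case False
    with that have "W \<subset> V" "connected_set E W"
      by (auto simp: deletions_def removable_def)
    then show ?thesis
      using psubset by (intro psubset.IH inj_on_subset[OF psubset.prems(2)]) auto
  qed (simp add: induced_value_empty)
  then have "induced_value E' ` deletions E' (f ` V) = induced_value E ` deletions E V"
    using psubset.prems by (subst deletions_iso) (auto simp: image_image)
  moreover have "connected_set E' (f ` V)"
    using psubset.prems by (auto intro: connected_set_image)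
  ultimately show ?case
    using assms psubset by (simp add: induced_value_mex)
qed

subsection \<open>Rooted trees and paths\<close>

text \<open>The parent function is total; the guards discard its value at the root.\<close>

definition tree_edges :: "('a \<Rightarrow> 'a) \<Rightarrow> 'a \<Rightarrow> 'a rel" where
  "tree_edges par rt = {(x, y). x \<noteq> rt \<and> y = par x \<or> y \<noteq> rt \<and> x = par y}"

lemma sym_tree_edges: "sym (tree_edges par rt)"
  by (auto simp: tree_edges_def sym_def)

text \<open>A connected set in a rooted tree has a unique vertex whose parent it lacks, namely its
  shallowest one. This turns connectivity into a local test on parents.\<close>

lemma connected_set_tree_iff:
  fixes dep :: "'a \<Rightarrow> nat"
  assumes dep: "\<And>x. x \<noteq> rt \<Longrightarrow> dep (par x) < dep x"
  shows "connected_set (tree_edges par rt) V \<longleftrightarrow>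
    (\<exists>r\<in>V. \<forall>x\<in>V. x \<noteq> r \<longrightarrow> x \<noteq> rt \<and> par x \<in> V)"
proof
  assume con: "connected_set (tree_edges par rt) V"
  then obtain v where "v \<in> V" by (auto simp: connected_set_def)
  define r where "r = (ARG_MIN dep x. x \<in> V)"
  have r: "r \<in> V" "\<And>x. x \<in> V \<Longrightarrow> dep r \<le> dep x"
    using arg_min_nat_lemma[of "\<lambda>x. x \<in> V" v dep] \<open>v \<in> V\<close> by (auto simp: r_def)
  define up where "up = {(x, y). x \<in> V \<and> y \<in> V \<and> x \<noteq> rt \<and> y = par x}"
  \<comment> \<open>Along a walk in \<open>V\<close> from \<open>r\<close>, every vertex keeps an
    ascending chain to \<open>r\<close>: a step downwards prepends an edge, and a step upwards
    follows the chain, as parents are unique. No step leads up from \<open>r\<close>, because its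
    depth is minimal.\<close>
  have chain: "(x, r) \<in> up\<^sup>*" if "(r, x) \<in> (tree_edges par rt \<inter> V \<times> V)\<^sup>*" for x
    using that
  proof (induction rule: rtrancl_induct)
    case (step y z)
    then consider "z \<noteq> rt" "y = par z" "y \<in> V" "z \<in> V" | "y \<noteq> rt" "z = par y" "y \<in> V" "z \<in> V"
      by (auto simp: tree_edges_def)
    then show ?case
    proof cases
      case 1
      then have "(z, y) \<in> up" by (auto simp: up_def)
      with step show ?thesis by (auto intro: converse_rtrancl_into_rtrancl)
    next
      case 2
      then have "y \<noteq> r"
        using dep[of y] r(2)[of z] by auto
      with step.IH obtain w where "(y, w) \<in> up" "(w, r) \<in> up\<^sup>*"
        by (auto elim: converse_rtranclE)
      with 2 show ?thesis by (auto simp: up_def)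
    qed
  qed auto
  have "x \<noteq> rt \<and> par x \<in> V" if "x \<in> V" "x \<noteq> r" for x
  proof -
    have "(x, r) \<in> up\<^sup>*"
      using con r(1) that by (intro chain) (auto simp: connected_set_def)
    with that obtain w where "(x, w) \<in> up"
      by (auto elim: converse_rtranclE)
    then show ?thesis by (auto simp: up_def)
  qed
  with r(1) show "\<exists>r\<in>V. \<forall>x\<in>V. x \<noteq> r \<longrightarrow> x \<noteq> rt \<and> par x \<in> V" by blast
next
  assume "\<exists>r\<in>V. \<forall>x\<in>V. x \<noteq> r \<longrightarrow> x \<noteq> rt \<and> par x \<in> V"
  then obtain r where r: "r \<in> V" "\<And>x. x \<in> V \<Longrightarrow> x \<noteq> r \<Longrightarrow> x \<noteq> rt \<and> par x \<in> V"
    by blast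
  let ?E = "tree_edges par rt \<inter> V \<times> V"
  have up: "(x, r) \<in> ?E\<^sup>*" if "x \<in> V" for x
    using that
  proof (induction x rule: measure_induct_rule[of dep])
    case (less x)
    show ?case
    proof (cases "x = r")
      case False
      with r less.prems have "x \<noteq> rt" "par x \<in> V" by auto
      then have "(x, par x) \<in> ?E" "(par x, r) \<in> ?E\<^sup>*"
        using less dep[of x] by (auto simp: tree_edges_def)
      then show ?thesis by (rule converse_rtrancl_into_rtrancl)
    qed simp
  qed
  have "sym ?E"
    using sym_tree_edges[of par rt] by (auto simp: sym_def)
  then have "sym (?E\<^sup>*)" by (rule sym_rtrancl)
  with up have "(x, y) \<in> ?E\<^sup>*" if "x \<in> V" "y \<in> V" for x y
    using that by (meson rtrancl_trans symD)
  with r(1) show "connected_set (tree_edges par rt) V"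
    unfolding connected_set_def by blast
qed

abbreviation path_edges :: "nat rel" where
  "path_edges \<equiv> tree_edges (\<lambda>x. x - 1) 0"

lemma connected_set_path_iff:
  "connected_set path_edges V \<longleftrightarrow> (\<exists>r\<in>V. \<forall>x\<in>V. x \<noteq> r \<longrightarrow> x \<noteq> 0 \<and> x - 1 \<in> V)"
  by (rule connected_set_tree_iff[of 0 id]) auto

lemma connected_set_path:
  assumes "finite V" "connected_set path_edges V"
  obtains a b where "a < b" "V = {a..<b}"
proof -
  obtain r where r: "r \<in> V" "\<And>x. x \<in> V \<Longrightarrow> x \<noteq> r \<Longrightarrow> x \<noteq> 0 \<and> x - 1 \<in> V"
    using assms(2) unfolding connected_set_path_iff by blast
  have down: "r \<le> x \<and> {r..x} \<subseteq> V" if "x \<in> V" for x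
    using that
  proof (induction x)
    case 0
    then show ?case using r by (cases "r = 0") auto
  next
    case (Suc x)
    show ?case
    proof (cases "r = Suc x")
      case False
      with r(2)[of "Suc x"] Suc have "r \<le> x" "{r..x} \<subseteq> V" by auto
      with Suc.prems show ?thesis by (auto simp: le_Suc_eq)
    qed (use Suc in auto)
  qed
  have "V = {r..<Suc (Max V)}"
    using down Max_in[OF assms(1)] Max_ge[OF assms(1)] r(1) by (fastforce simp: less_Suc_eq_le)
  moreover have "r < Suc (Max V)"
    using Max_ge[OF assms(1) r(1)] by simp
  ultimately show thesis using that by blast
qed

lemma connected_interval: "a < b \<Longrightarrow> connected_set path_edges {a..<b}"
  unfolding connected_set_path_iff by (intro bexI[of _ a]) auto

text \<open>What a legal deletion leaves of an interval is an interval, and counting gives its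
  length, so the place of the deleted set is irrelevant. The game thus becomes subtraction of 1 or
  2.\<close>

lemma path_value: "induced_value path_edges {a..<b} = (b - a) mod 3"
proof (induction "b - a" arbitrary: a b rule: less_induct)
  case less
  show ?case
  proof (cases "a < b")
    case True
    let ?S = "induced_value path_edges ` deletions path_edges {a..<b}"
    have "?S = {(b - a - d) mod 3 | d. d \<in> {1, 2} \<and> d \<le> b - a}"
    proof (intro equalityI subsetI)
      fix k assume "k \<in> ?S"
      then obtain X where X: "X \<subseteq> {a..<b}" "(\<exists>u. X = {u}) \<or> (\<exists>u v. (u, v) \<in> path_edges \<and> X = {u, v})"
        "{a..<b} - X = {} \<or> connected_set path_edges ({a..<b} - X)"
        and k: "k = induced_value path_edges ({a..<b} - X)"
        by (auto simp: deletions_def removable_def)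
      have card: "card X \<in> {1, 2}"
        using X(2) by (auto simp: tree_edges_def card_insert_if)
      have "\<exists>a' b'. {a..<b} - X = {a'..<b'}"
        using X(3)
      proof
        assume "{a..<b} - X = {}"
        then have "{a..<b} - X = {0..<0}" by simp
        then show ?thesis by blast
      next
        assume "connected_set path_edges ({a..<b} - X)"
        then show ?thesis by (rule connected_set_path[rotated]) auto
      qed
      then obtain a' b' where ab: "{a..<b} - X = {a'..<b'}" by blast
      have "b' - a' = b - a - card X"
        using arg_cong[OF ab, of card] card_Diff_subset[of X "{a..<b}"] X(1)
        by (simp add: finite_subset)
      moreover have "card X \<le> b - a"
        using card_mono[OF _ X(1)] by simp
      moreover have "k = (b' - a') mod 3"
        using k ab less[of b' a'] calculation card True by auto
      ultimately show "k \<in> {(b - a - d) mod 3 | d. d \<in> {1, 2} \<and> d \<le> b - a}"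
        using card by (intro CollectI exI[of _ "card X"]) simp
    next
      fix k assume "k \<in> {(b - a - d) mod 3 | d. d \<in> {1, 2} \<and> d \<le> b - a}"
      then obtain d where d: "k = (b - a - d) mod 3" "d \<in> {1, 2}" "d \<le> b - a" by blast
      have "{a + d..<b} = {a..<b} - {a..<a + d}" by auto
      moreover have "{a..<a + d} \<subseteq> {a..<b}" using d True by auto
      moreover have "{a..<a + d} = {a} \<or> {a..<a + d} = {a, a + 1} \<and> (a, a + 1) \<in> path_edges"
        using d by (auto simp: tree_edges_def)
      moreover have "{a + d..<b} = {} \<or> connected_set path_edges {a + d..<b}"
        using connected_interval[of "a + d" b] by (cases "a + d < b") auto
      ultimately have "{a + d..<b} \<in> deletions path_edges {a..<b}"
        unfolding deletions_def removable_def by (intro CollectI exI[of _ "{a..<a + d}"]) metis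
      moreover have "induced_value path_edges {a + d..<b} = k"
        using less[of b "a + d"] d True by auto
      ultimately show "k \<in> ?S" by force
    qed
    also have "mex \<dots> = (b - a) mod 3"
    proof (rule mex_eqI)
      have *: "(n - d) mod 3 \<noteq> n mod 3" if "d \<in> {1, 2}" "d \<le> n" for n d :: nat
      proof
        assume "(n - d) mod 3 = n mod 3"
        then have "3 dvd d"
          using that mod_eq_dvd_iff_nat[of "n - d" n 3] by (simp add: eq_commute)
        with that show False by auto
      qed
      show "(b - a) mod 3 \<notin> {(b - a - d) mod 3 | d. d \<in> {1, 2} \<and> d \<le> b - a}"
      proof
        assume "(b - a) mod 3 \<in> {(b - a - d) mod 3 | d. d \<in> {1, 2} \<and> d \<le> b - a}"
        then obtain d where "d \<in> {1, 2}" "d \<le> b - a" "(b - a) mod 3 = (b - a - d) mod 3"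
          by blast
        with *[of d "b - a"] show False by metis
      qed
    next
      fix k assume k: "k < (b - a) mod 3"
      \<comment> \<open>The amount that brings the residue down to \<open>k\<close>; it is 1 or 2
        since the residue is at most 2.\<close>
      define d where "d = (b - a) mod 3 - k"
      have "d \<le> b - a"
        unfolding d_def by (meson diff_le_self le_trans mod_less_eq_dividend)
      moreover have "(b - a) mod 3 < 3" by simp
      then have "d \<in> {1, 2}"
        using k unfolding d_def by auto
      moreover have "b - a - d = k + 3 * ((b - a) div 3)"
        using k div_mult_mod_eq[of "b - a" 3] unfolding d_def by linarith
      then have "k = (b - a - d) mod 3"
        using k by simp
      ultimately show "k \<in> {(b - a - d) mod 3 | d. d \<in> {1, 2} \<and> d \<le> b - a}"
        by blast
    qed
    finally show ?thesis
      unfolding induced_value_mex[OF sym_tree_edges connected_interval[OF True] finite_atLeastLessThan] .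
  qed (simp add: induced_value_empty)
qed

subsection \<open>Bistars as rooted trees\<close>

fun bistar_parent :: "nat \<Rightarrow> bistar_vertex \<Rightarrow> bistar_vertex" where
  "bistar_parent m (LeftStar Centre) = LeftStar Centre"
| "bistar_parent m (LeftStar (Arm i j)) = (if j \<le> 1 then LeftStar Centre else LeftStar (Arm i (j - 1)))"
| "bistar_parent m (Link i) = (if i \<le> 1 then LeftStar Centre else Link (i - 1))"
| "bistar_parent m (RightStar Centre) = (if m \<le> 1 then LeftStar Centre else Link (m - 1))"
| "bistar_parent m (RightStar (Arm i j)) =
     (if 1 < j then RightStar (Arm i (j - 1)) else if m = 0 then LeftStar Centre else RightStar Centre)"

text \<open>Not the distance from the root: only strict decrease towards the parent is required. The
  offsets ensure it for every \<open>m\<close> and also for index 0, which names no vertex.\<close>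

fun bistar_depth :: "nat \<Rightarrow> bistar_vertex \<Rightarrow> nat" where
  "bistar_depth m (LeftStar Centre) = 0"
| "bistar_depth m (LeftStar (Arm i j)) = j + 1"
| "bistar_depth m (Link i) = i + 1"
| "bistar_depth m (RightStar Centre) = m + 1"
| "bistar_depth m (RightStar (Arm i j)) = m + j + 2"

lemma bistar_depth_parent:
  "x \<noteq> LeftStar Centre \<Longrightarrow> bistar_depth m (bistar_parent m x) < bistar_depth m x"
  by (cases "(m, x)" rule: bistar_parent.cases) auto

abbreviation bistar_edges :: "nat \<Rightarrow> bistar_vertex rel" where
  "bistar_edges m \<equiv> tree_edges (bistar_parent m) (LeftStar Centre)"

fun in_bistar :: "nat list \<Rightarrow> nat \<Rightarrow> nat list \<Rightarrow> bistar_vertex \<Rightarrow> bool" where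
  "in_bistar A m B (LeftStar Centre) \<longleftrightarrow> True"
| "in_bistar A m B (LeftStar (Arm i j)) \<longleftrightarrow> i < length A \<and> 1 \<le> j \<and> j \<le> A ! i"
| "in_bistar A m B (Link i) \<longleftrightarrow> 1 \<le> i \<and> i < m"
| "in_bistar A m B (RightStar Centre) \<longleftrightarrow> 0 < m"
| "in_bistar A m B (RightStar (Arm i j)) \<longleftrightarrow> i < length B \<and> 1 \<le> j \<and> j \<le> B ! i"

definition bistar_verts :: "nat list \<Rightarrow> nat \<Rightarrow> nat list \<Rightarrow> bistar_vertex set" where
  "bistar_verts A m B = {v. in_bistar A m B v}"

lemma in_bistar_verts [simp]: "v \<in> bistar_verts A m B \<longleftrightarrow> in_bistar A m B v"
  by (simp add: bistar_verts_def)

lemma bistar_vertex_exhaust: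
  obtains "v = LeftStar Centre" | i j where "v = LeftStar (Arm i j)" | i where "v = Link i"
    | "v = RightStar Centre" | i j where "v = RightStar (Arm i j)"
  by (metis bistar_vertex.exhaust star_vertex.exhaust)

lemma bistar_verts_eq:
  "bistar_verts A m B = {LeftStar Centre} \<union> Link ` {1..<m} \<union> (if m = 0 then {} else {RightStar Centre})
    \<union> (\<lambda>(i, j). LeftStar (Arm i j)) ` (SIGMA i:{..<length A}. {1..A ! i})
    \<union> (\<lambda>(i, j). RightStar (Arm i j)) ` (SIGMA i:{..<length B}. {1..B ! i})" (is "_ = ?R")
proof (rule set_eqI)
  fix v show "v \<in> bistar_verts A m B \<longleftrightarrow> v \<in> ?R"
    by (cases v rule: bistar_vertex_exhaust) auto
qed

lemma finite_bistar_verts [simp]: "finite (bistar_verts A m B)"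
  unfolding bistar_verts_eq by auto

lemma in_bistar_parent: "in_bistar A m B x \<Longrightarrow> in_bistar A m B (bistar_parent m x)"
  by (cases x rule: bistar_vertex_exhaust) auto

lemma connected_set_bistar_iff:
  "connected_set (bistar_edges m) V \<longleftrightarrow>
    (\<exists>r\<in>V. \<forall>x\<in>V. x \<noteq> r \<longrightarrow> x \<noteq> LeftStar Centre \<and> bistar_parent m x \<in> V)"
  by (rule connected_set_tree_iff[of _ "bistar_depth m"]) (rule bistar_depth_parent)

lemma connected_bistar_verts: "connected_set (bistar_edges m) (bistar_verts A m B)"
  unfolding connected_set_bistar_iff
  by (intro bexI[of _ "LeftStar Centre"]) (auto intro: in_bistar_parent)

lemma parcs_mk_symmetric_with_proj:
  "parcs (mk_symmetric (with_proj \<lparr>pverts = V, parcs = R\<rparr>)) = R \<union> R\<inverse>"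
  by (auto simp: parcs_mk_symmetric)

text \<open>Before symmetrisation every arc of the construction points from a parent to its child,
  and each vertex except the left centre is the child in one of them.\<close>

lemma subdivided_bistar_eq:
  "with_proj (subdivided_bistar (subdivided_star A) m (subdivided_star B)) =
     induced_graph (bistar_edges m) (bistar_verts A m B)"
proof -
  let ?G = "subdivided_bistar (subdivided_star A) m (subdivided_star B)"
  let ?V = "bistar_verts A m B"
  define S where "S ls = {(Centre, Arm i 1) | i. i < length ls \<and> 1 \<le> ls ! i}
             \<union> {(Arm i j, Arm i (j + 1)) | i j. i < length ls \<and> 1 \<le> j \<and> j + 1 \<le> ls ! i}" for ls :: "nat list"
  define r where "r = (\<lambda>v. if m = 0 \<and> v = Centre then LeftStar Centre else RightStar v)"
  define p where "p = (\<lambda>i. if i = 0 then LeftStar Centre else if i < m then Link i else RightStar Centre)"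
  define R where "R = map_prod LeftStar LeftStar ` S A \<union> map_prod r r ` S B \<union> {(p i, p (i + 1)) | i. i < m}"
  have star: "parcs (subdivided_star ls) = S ls \<union> (S ls)\<inverse>"
    "pverts (subdivided_star ls) = {Centre} \<union> {Arm i j | i j. i < length ls \<and> 1 \<le> j \<and> j \<le> ls ! i}" for ls
    unfolding subdivided_star_def S_def parcs_mk_symmetric_with_proj by simp_all
  have "pverts ?G = LeftStar ` pverts (subdivided_star A) \<union> r ` pverts (subdivided_star B) \<union> Link ` {1..<m}"
    unfolding subdivided_bistar_def Let_def r_def p_def by simp
  also have "\<dots> = ?V"
  proof (rule set_eqI)
    fix v show "v \<in> LeftStar ` pverts (subdivided_star A) \<union> r ` pverts (subdivided_star B) \<union> Link ` {1..<m}
      \<longleftrightarrow> v \<in> ?V"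
      by (cases v rule: bistar_vertex_exhaust) (auto simp: star r_def)
  qed
  finally have verts: "pverts ?G = ?V" .
  have "parcs ?G = R \<union> R\<inverse>"
    unfolding subdivided_bistar_def Let_def R_def r_def[symmetric] p_def[symmetric]
      parcs_mk_symmetric_with_proj star
    by (auto simp: map_prod_def image_iff)
  also have "R = {(bistar_parent m v, v) | v. v \<in> ?V \<and> v \<noteq> LeftStar Centre}"
  proof (intro equalityI subsetI)
    fix e assume "e \<in> R"
    then show "e \<in> {(bistar_parent m v, v) | v. v \<in> ?V \<and> v \<noteq> LeftStar Centre}"
      by (auto simp: R_def S_def r_def p_def)
  next
    fix e assume "e \<in> {(bistar_parent m v, v) | v. v \<in> ?V \<and> v \<noteq> LeftStar Centre}"
    then obtain v where e: "e = (bistar_parent m v, v)" and v: "in_bistar A m B v" "v \<noteq> LeftStar Centre"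
      by auto
    show "e \<in> R"
    proof (cases v rule: bistar_vertex_exhaust)
      case 1
      with v show ?thesis by simp
    next
      case (2 i j)
      have "\<exists>a. (a, Arm i j) \<in> S A \<and> LeftStar a = bistar_parent m v"
      proof (cases "j = 1")
        case True
        then show ?thesis using 2 v by (intro exI[of _ Centre]) (auto simp: S_def)
      next
        case False
        then show ?thesis using 2 v by (intro exI[of _ "Arm i (j - 1)"]) (auto simp: S_def)
      qed
      then obtain a where "(a, Arm i j) \<in> S A" "LeftStar a = bistar_parent m v" by blast
      then have "e = map_prod LeftStar LeftStar (a, Arm i j)" "(a, Arm i j) \<in> S A"
        using e 2 by auto
      then show ?thesis unfolding R_def by blast
    next
      case (3 i)
      then have "e = (p (i - 1), p (i - 1 + 1))" "i - 1 < m"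
        using v by (auto simp: e p_def)
      then show ?thesis unfolding R_def by blast
    next
      case 4
      then have "e = (p (m - 1), p (m - 1 + 1))" "m - 1 < m"
        using v by (auto simp: e p_def)
      then show ?thesis unfolding R_def by blast
    next
      case (5 i j)
      have "\<exists>a. (a, Arm i j) \<in> S B \<and> r a = bistar_parent m v"
      proof (cases "j = 1")
        case True
        then show ?thesis using 5 v by (intro exI[of _ Centre]) (auto simp: S_def r_def)
      next
        case False
        then show ?thesis using 5 v by (intro exI[of _ "Arm i (j - 1)"]) (auto simp: S_def r_def)
      qed
      then obtain a where "(a, Arm i j) \<in> S B" "r a = bistar_parent m v" by blast
      then have "e = map_prod r r (a, Arm i j)" "(a, Arm i j) \<in> S B"
        using e 5 by (auto simp: r_def)
      then show ?thesis unfolding R_def by blast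
    qed
  qed
  finally have "parcs ?G = bistar_edges m \<inter> ?V \<times> ?V"
    by (auto simp: tree_edges_def in_bistar_parent)
  with verts show ?thesis
    unfolding induced_graph_def by (metis (full_types) old.unit.exhaust pair_pre_digraph.surjective)
qed

section \<open>Legal deletions from a branching bistar\<close>

lemma nonzeros_mset: "nonzeros (mset xs) = card {i. i < length xs \<and> xs ! i \<noteq> 0}"
  unfolding nonzeros_def by (simp add: length_filter_conv_card flip: mset_filter)

lemma bistar_verts_shorten_left:
  "i < length A \<Longrightarrow>
    bistar_verts A m B - {LeftStar (Arm i j) | j. A ! i - d < j \<and> j \<le> A ! i}
      = bistar_verts (A[i := A ! i - d]) m B"
proof (rule set_eqI)
  fix v assume "i < length A"
  then show "v \<in> bistar_verts A m B - {LeftStar (Arm i j) | j. A ! i - d < j \<and> j \<le> A ! i}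
      \<longleftrightarrow> v \<in> bistar_verts (A[i := A ! i - d]) m B"
    by (cases v rule: bistar_vertex_exhaust) (auto simp: nth_list_update)
qed

lemma bistar_verts_shorten_right:
  "i < length B \<Longrightarrow>
    bistar_verts A m B - {RightStar (Arm i j) | j. B ! i - d < j \<and> j \<le> B ! i}
      = bistar_verts A m (B[i := B ! i - d])"
proof (rule set_eqI)
  fix v assume "i < length B"
  then show "v \<in> bistar_verts A m B - {RightStar (Arm i j) | j. B ! i - d < j \<and> j \<le> B ! i}
      \<longleftrightarrow> v \<in> bistar_verts A m (B[i := B ! i - d])"
    by (cases v rule: bistar_vertex_exhaust) (auto simp: nth_list_update)
qed

text \<open>The list form of \<open>arm_moves\<close>: vertices record the position of their arm,
  which a multiset forgets.\<close>

definition shortenings :: "nat list \<Rightarrow> nat list set" where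
  "shortenings A = {A[i := A ! i - d] | i d. i < length A \<and> d \<in> {1, 2} \<and> d \<le> A ! i}"

lemma shorteningsI:
  "i < length A \<Longrightarrow> d \<in> {1, 2} \<Longrightarrow> d \<le> A ! i \<Longrightarrow> A[i := A ! i - d] \<in> shortenings A"
  unfolding shortenings_def by blast

text \<open>Three branches protect the root: deleting it with one neighbour still leaves two of them
  disconnected. For positive \<open>m\<close> the third branch is the link.\<close>

lemma bistar_branching_at_root:
  assumes "if m = 0 then 3 \<le> nonzeros (mset A) + nonzeros (mset B) else 2 \<le> nonzeros (mset A)"
  shows "3 \<le> card {x \<in> bistar_verts A m B. x \<noteq> LeftStar Centre \<and> bistar_parent m x = LeftStar Centre}"
proof -
  define C where "C = {x \<in> bistar_verts A m B. x \<noteq> LeftStar Centre \<and> bistar_parent m x = LeftStar Centre}"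
  define L where "L = (\<lambda>i. LeftStar (Arm i 1)) ` {i. i < length A \<and> A ! i \<noteq> 0}"
  define R where "R = (\<lambda>i. RightStar (Arm i 1)) ` {i. i < length B \<and> B ! i \<noteq> 0}"
  have fin: "finite C" "finite L" "finite R"
    unfolding C_def L_def R_def by (rule finite_subset[OF _ finite_bistar_verts[of A m B]]) auto
  have cards: "card L = nonzeros (mset A)" "card R = nonzeros (mset B)"
    unfolding nonzeros_mset L_def R_def by (intro card_image inj_onI; simp)+
  show ?thesis
    unfolding C_def[symmetric]
  proof (cases "m = 0")
    case True
    have "L \<inter> R = {}"
      by (auto simp: L_def R_def)
    then have "card (L \<union> R) = nonzeros (mset A) + nonzeros (mset B)"
      using fin cards by (simp add: card_Un_disjoint)
    moreover have "L \<union> R \<subseteq> C"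
      using True by (auto simp: L_def R_def C_def)
    then have "card (L \<union> R) \<le> card C"
      by (rule card_mono[OF fin(1)])
    ultimately show "3 \<le> card C"
      using assms True by simp
  next
    case False
    define l where "l = (if m = 1 then RightStar Centre else Link 1)"
    have "l \<notin> L"
      by (auto simp: L_def l_def)
    then have "card (insert l L) = Suc (nonzeros (mset A))"
      using fin cards by simp
    moreover have "insert l L \<subseteq> C"
      using False by (auto simp: L_def C_def l_def)
    then have "card (insert l L) \<le> card C"
      by (rule card_mono[OF fin(1)])
    ultimately show "3 \<le> card C"
      using assms False by simp
  qed
qed

lemma bistar_branching_at_right_centre:
  assumes "0 < m" "2 \<le> nonzeros (mset B)"
  shows "2 \<le> card {x \<in> bistar_verts A m B. bistar_parent m x = RightStar Centre}" (is "2 \<le> card ?C")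
proof -
  let ?R = "(\<lambda>i. RightStar (Arm i 1)) ` {i. i < length B \<and> B ! i \<noteq> 0}"
  have "card ?R = nonzeros (mset B)"
    unfolding nonzeros_mset by (intro card_image inj_onI; simp)
  moreover have "?R \<subseteq> ?C"
    using assms by auto
  moreover have "finite ?C"
    by (rule finite_subset[OF _ finite_bistar_verts[of A m B]]) auto
  ultimately show ?thesis
    using assms card_mono[of ?C ?R] by simp
qed

text \<open>As the root survives, the deleted set is closed under children. Having at most two
  elements, it cannot reach a centre or the link, so it is the tail of a single arm.\<close>

lemma bistar_removable_tail:
  assumes branch: "if m = 0 then 3 \<le> nonzeros (mset A) + nonzeros (mset B)
    else 2 \<le> nonzeros (mset A) \<and> 2 \<le> nonzeros (mset B)"
    and X: "removable (bistar_edges m) (bistar_verts A m B) X"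
  shows "bistar_verts A m B - X \<in> (\<lambda>A'. bistar_verts A' m B) ` shortenings A
    \<union> (\<lambda>B'. bistar_verts A m B') ` shortenings B"
proof -
  let ?V = "bistar_verts A m B"
  let ?c = "LeftStar Centre"
  define C where "C = {x \<in> ?V. x \<noteq> ?c \<and> bistar_parent m x = ?c}"
  have C: "3 \<le> card C" "C \<subseteq> ?V" "?c \<notin> C"
    using bistar_branching_at_root[of m A B] branch by (auto simp: C_def split: if_splits)
  have XV: "X \<subseteq> ?V" and shape: "(\<exists>u. X = {u}) \<or> (\<exists>u v. (u, v) \<in> bistar_edges m \<and> X = {u, v})"
    and con: "?V - X = {} \<or> connected_set (bistar_edges m) (?V - X)"
    using X by (auto simp: removable_def)
  have finX: "finite X" using XV by (rule finite_subset) simp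
  have cardX: "card X \<le> 2"
    using shape by (auto simp: card_insert_if)
  have "\<not> C \<subseteq> X"
    using card_mono[OF finX, of C] C(1) cardX by linarith
  then have "?V - X \<noteq> {}"
    using C(2) by blast
  with con obtain r where r: "r \<in> ?V - X"
    "\<And>x. x \<in> ?V - X \<Longrightarrow> x \<noteq> r \<Longrightarrow> x \<noteq> ?c \<and> bistar_parent m x \<in> ?V - X"
    unfolding connected_set_bistar_iff by blast
  \<comment> \<open>If the root were deleted, at least two of its children would remain without
    their parent, but a connected rest admits only one such vertex.\<close>
  have root: "?c \<notin> X"
  proof
    assume c: "?c \<in> X"
    then have "C - X = C - (X - {?c})"
      using C(3) by auto
    then have "card (C - X) \<ge> card C - card (X - {?c})"
      using diff_card_le_card_Diff[of "X - {?c}" C] finX by simp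
    then have "2 \<le> card (C - X)"
      using C(1) c cardX finX by simp
    moreover have "x = r" if "x \<in> C - X" for x
      using r(2)[of x] that c by (auto simp: C_def)
    then have "C - X \<subseteq> {r}" by blast
    then have "card (C - X) \<le> 1"
      using card_mono[of "{r}"] by fastforce
    ultimately show False by linarith
  qed
  then have "r = ?c"
    using r(2)[of ?c] by auto
  then have closed: "x \<in> X" if "in_bistar A m B x" "x \<noteq> ?c" "bistar_parent m x \<in> X" for x
    using r(2)[of x] that by auto
  \<comment> \<open>With the right centre its children would go as well, and there are at least two
    of them.\<close>
  have right: "RightStar Centre \<notin> X" if m: "0 < m"
  proof
    assume R: "RightStar Centre \<in> X"
    define D where "D = {x \<in> ?V. bistar_parent m x = RightStar Centre}"
    have "D \<subseteq> X - {RightStar Centre}"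
    proof
      fix x assume "x \<in> D"
      then have "in_bistar A m B x" "bistar_parent m x = RightStar Centre"
        by (auto simp: D_def)
      moreover from this(2) have "x \<noteq> ?c" "x \<noteq> RightStar Centre"
        by (auto split: if_splits)
      ultimately show "x \<in> X - {RightStar Centre}"
        using closed[of x] R by simp
    qed
    then have "card D \<le> card (X - {RightStar Centre})"
      using finX by (intro card_mono) auto
    then have "card D \<le> 1"
      using R cardX finX by simp
    moreover have "2 \<le> card D"
      unfolding D_def using branch m by (intro bistar_branching_at_right_centre) auto
    ultimately show False by linarith
  qed
  \<comment> \<open>Closure under children passes a deletion along the link until it hits the right
    centre.\<close>
  have link: "Link i \<notin> X" for i
  proof
    assume "Link i \<in> X"
    then show False
    proof (induction "m - i" arbitrary: i rule: less_induct)
      case less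
      have i: "1 \<le> i" "i < m"
        using less.prems XV by auto
      show False
      proof (cases "Suc i < m")
        case True
        have "Link (Suc i) \<in> X"
          using less.prems i True closed[of "Link (Suc i)"] by simp
        with less.hyps[of "Suc i"] i show False by (simp add: diff_less_mono2)
      next
        case False
        then have "m = Suc i" using i by simp
        then have "RightStar Centre \<in> X"
          using less.prems i closed[of "RightStar Centre"] by simp
        with right i show False by auto
      qed
    qed
  qed
  have left_end: "j = A ! i" if "LeftStar (Arm i j) \<in> X" "LeftStar (Arm i (Suc j)) \<notin> X" for i j
    using closed[of "LeftStar (Arm i (Suc j))"] that XV by fastforce
  have right_end: "j = B ! i" if "RightStar (Arm i j) \<in> X" "RightStar (Arm i (Suc j)) \<notin> X" for i j
    using closed[of "RightStar (Arm i (Suc j))"] that XV by fastforce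
  have left: ?thesis if "X = {LeftStar (Arm i j) | j. A ! i - d < j \<and> j \<le> A ! i}"
    "i < length A" "d \<in> {1, 2}" "d \<le> A ! i" for i d
    using bistar_verts_shorten_left[of i A m B d] that shorteningsI[of i A d] by auto
  have right': ?thesis if "X = {RightStar (Arm i j) | j. B ! i - d < j \<and> j \<le> B ! i}"
    "i < length B" "d \<in> {1, 2}" "d \<le> B ! i" for i d
    using bistar_verts_shorten_right[of i B A m d] that shorteningsI[of i B d] by auto
  consider u where "X = {u}" | v where "v \<noteq> ?c" "X = {bistar_parent m v, v}"
    using shape by (auto simp: tree_edges_def insert_commute)
  then show ?thesis
  proof cases
    case (1 u)
    then have "u \<in> ?V" using XV by auto
    show ?thesis
    proof (cases u rule: bistar_vertex_exhaust)
      case (2 i j)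
      have j: "j = A ! i"
        using left_end[of i j] 1 2 by auto
      then have "X = {LeftStar (Arm i j) | j. A ! i - 1 < j \<and> j \<le> A ! i}" "1 \<le> A ! i"
        using 1 2 \<open>u \<in> ?V\<close> by auto
      then show ?thesis
        using left[of i 1] 2 \<open>u \<in> ?V\<close> by auto
    next
      case (5 i j)
      have j: "j = B ! i"
        using right_end[of i j] 1 5 by auto
      then have "X = {RightStar (Arm i j) | j. B ! i - 1 < j \<and> j \<le> B ! i}" "1 \<le> B ! i"
        using 1 5 \<open>u \<in> ?V\<close> by auto
      then show ?thesis
        using right'[of i 1] 5 \<open>u \<in> ?V\<close> by auto
    qed (use 1 root link right \<open>u \<in> ?V\<close> in auto)
  next
    case (2 v)
    then have "v \<in> ?V" using XV by auto
    show ?thesis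
    proof (cases v rule: bistar_vertex_exhaust)
      case (2 i j)
      then have 1: "1 < j" "X = {LeftStar (Arm i (j - 1)), LeftStar (Arm i j)}"
        using \<open>X = {bistar_parent m v, v}\<close> root by (auto split: if_splits)
      then have j: "j = A ! i"
        using left_end[of i j] by auto
      then have "X = {LeftStar (Arm i j) | j. A ! i - 2 < j \<and> j \<le> A ! i}"
        using 1 by (auto simp: le_less)
      then show ?thesis
        using left[of i 2] 1 2 j \<open>v \<in> ?V\<close> by auto
    next
      case (5 i j)
      then have 1: "1 < j" "X = {RightStar (Arm i (j - 1)), RightStar (Arm i j)}"
        using \<open>X = {bistar_parent m v, v}\<close> root right by (auto split: if_splits)
      then have j: "j = B ! i"
        using right_end[of i j] by auto
      then have "X = {RightStar (Arm i j) | j. B ! i - 2 < j \<and> j \<le> B ! i}"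
        using 1 by (auto simp: le_less)
      then show ?thesis
        using right'[of i 2] 1 5 j \<open>v \<in> ?V\<close> by auto
    qed (use 2 root link right \<open>v \<in> ?V\<close> in auto)
  qed
qed

lemma shorten_left_removable:
  assumes "i < length A" "d \<in> {1, 2}" "d \<le> A ! i"
  shows "removable (bistar_edges m) (bistar_verts A m B) {LeftStar (Arm i j) | j. A ! i - d < j \<and> j \<le> A ! i}"
proof -
  define X where "X = {LeftStar (Arm i j) | j. A ! i - d < j \<and> j \<le> A ! i}"
  have "bistar_verts A m B - X = bistar_verts (A[i := A ! i - d]) m B"
    unfolding X_def using assms by (intro bistar_verts_shorten_left) auto
  then have "connected_set (bistar_edges m) (bistar_verts A m B - X)"
    by (simp add: connected_bistar_verts)
  moreover have "X = {LeftStar (Arm i (A ! i))} \<or> X = {LeftStar (Arm i (A ! i)), LeftStar (Arm i (A ! i - 1))}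
    \<and> (LeftStar (Arm i (A ! i)), LeftStar (Arm i (A ! i - 1))) \<in> bistar_edges m"
  proof (cases "d = 1")
    case True
    then have "A ! i - d < j \<and> j \<le> A ! i \<longleftrightarrow> j = A ! i" for j
      using assms by auto
    then show ?thesis unfolding X_def by auto
  next
    case False
    then have "A ! i - d < j \<and> j \<le> A ! i \<longleftrightarrow> j = A ! i \<or> j = A ! i - 1" for j
      using assms by auto
    moreover have "2 \<le> A ! i"
      using assms False by auto
    ultimately show ?thesis unfolding X_def by (auto simp: tree_edges_def)
  qed
  moreover have "X \<subseteq> bistar_verts A m B"
    using assms by (auto simp: X_def)
  ultimately show ?thesis
    unfolding removable_def X_def[symmetric] by blast
qed

lemma shorten_right_removable:
  assumes "i < length B" "d \<in> {1, 2}" "d \<le> B ! i"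
  shows "removable (bistar_edges m) (bistar_verts A m B) {RightStar (Arm i j) | j. B ! i - d < j \<and> j \<le> B ! i}"
proof -
  define X where "X = {RightStar (Arm i j) | j. B ! i - d < j \<and> j \<le> B ! i}"
  have "bistar_verts A m B - X = bistar_verts A m (B[i := B ! i - d])"
    unfolding X_def using assms by (intro bistar_verts_shorten_right) auto
  then have "connected_set (bistar_edges m) (bistar_verts A m B - X)"
    by (simp add: connected_bistar_verts)
  moreover have "X = {RightStar (Arm i (B ! i))} \<or> X = {RightStar (Arm i (B ! i)), RightStar (Arm i (B ! i - 1))}
    \<and> (RightStar (Arm i (B ! i)), RightStar (Arm i (B ! i - 1))) \<in> bistar_edges m"
  proof (cases "d = 1")
    case True
    then have "B ! i - d < j \<and> j \<le> B ! i \<longleftrightarrow> j = B ! i" for j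
      using assms by auto
    then show ?thesis unfolding X_def by auto
  next
    case False
    then have "B ! i - d < j \<and> j \<le> B ! i \<longleftrightarrow> j = B ! i \<or> j = B ! i - 1" for j
      using assms by auto
    moreover have "2 \<le> B ! i"
      using assms False by auto
    ultimately show ?thesis unfolding X_def by (auto simp: tree_edges_def)
  qed
  moreover have "X \<subseteq> bistar_verts A m B"
    using assms by (auto simp: X_def)
  ultimately show ?thesis
    unfolding removable_def X_def[symmetric] by blast
qed

lemma deletionsI: "removable E V X \<Longrightarrow> V - X = W \<Longrightarrow> W \<in> deletions E V"
  unfolding deletions_def by blast

lemma deletions_bistar:
  assumes "if m = 0 then 3 \<le> nonzeros (mset A) + nonzeros (mset B)
    else 2 \<le> nonzeros (mset A) \<and> 2 \<le> nonzeros (mset B)"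
  shows "deletions (bistar_edges m) (bistar_verts A m B) =
    (\<lambda>A'. bistar_verts A' m B) ` shortenings A \<union> (\<lambda>B'. bistar_verts A m B') ` shortenings B"
proof (intro equalityI subsetI)
  fix W assume "W \<in> deletions (bistar_edges m) (bistar_verts A m B)"
  then show "W \<in> (\<lambda>A'. bistar_verts A' m B) ` shortenings A \<union> (\<lambda>B'. bistar_verts A m B') ` shortenings B"
    using bistar_removable_tail[OF assms] unfolding deletions_def by blast
next
  fix W assume "W \<in> (\<lambda>A'. bistar_verts A' m B) ` shortenings A \<union> (\<lambda>B'. bistar_verts A m B') ` shortenings B"
  then consider i d where "i < length A" "d \<in> {1, 2}" "d \<le> A ! i" "W = bistar_verts (A[i := A ! i - d]) m B"
    | i d where "i < length B" "d \<in> {1, 2}" "d \<le> B ! i" "W = bistar_verts A m (B[i := B ! i - d])"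
    unfolding shortenings_def by blast
  then show "W \<in> deletions (bistar_edges m) (bistar_verts A m B)"
  proof cases
    case 1
    then show ?thesis
      by (simp only: deletionsI[OF shorten_left_removable bistar_verts_shorten_left])
  next
    case 2
    then show ?thesis
      by (simp only: deletionsI[OF shorten_right_removable bistar_verts_shorten_right])
  qed
qed

lemma mset_shortenings: "mset ` shortenings A = arm_moves (mset A)"
proof (intro equalityI subsetI)
  fix M assume "M \<in> mset ` shortenings A"
  then obtain i d where i: "i < length A" and d: "d \<in> {1, 2}" "d \<le> A ! i"
    and M: "M = mset (A[i := A ! i - d])"
    unfolding shortenings_def by blast
  have "mset A = add_mset (A ! i) (mset A - {#A ! i#})"
    using i by simp
  moreover have "M = add_mset (A ! i - d) (mset A - {#A ! i#})"
    unfolding M using i by (rule mset_update)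
  moreover have "A ! i - d < A ! i" "A ! i \<le> A ! i - d + 2"
    using d by auto
  ultimately show "M \<in> arm_moves (mset A)"
    using arm_movesI by metis
next
  fix M assume "M \<in> arm_moves (mset A)"
  then obtain x y N where M: "mset A = add_mset x N" "M = add_mset y N" "y < x" "x \<le> y + 2"
    by (rule arm_movesE)
  then have "x \<in> set A"
    by (metis set_mset_mset union_single_eq_member)
  then obtain i where i: "i < length A" "A ! i = x"
    by (auto simp: in_set_conv_nth)
  have "A[i := A ! i - (x - y)] \<in> shortenings A"
    using M i by (intro shorteningsI) auto
  moreover have "mset (A[i := A ! i - (x - y)]) = M"
    using M i by (simp add: mset_update)
  ultimately show "M \<in> mset ` shortenings A" by blast
qed

subsection \<open>Isomorphisms between bistars, stars and paths\<close>

lemma card_star_verts: "card (bistar_verts A 0 B) = 1 + sum_list A + sum_list B"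
proof -
  define L where "L = (\<lambda>(i, j). LeftStar (Arm i j)) ` (SIGMA i:{..<length A}. {1..A ! i})"
  define R where "R = (\<lambda>(i, j). RightStar (Arm i j)) ` (SIGMA i:{..<length B}. {1..B ! i})"
  have "bistar_verts A 0 B = insert (LeftStar Centre) (L \<union> R)"
    unfolding bistar_verts_eq L_def R_def by auto
  moreover have "finite L" "finite R" "LeftStar Centre \<notin> L \<union> R" "L \<inter> R = {}"
    by (auto simp: L_def R_def)
  moreover have "card L = sum_list A" "card R = sum_list B"
    unfolding L_def R_def
    by (subst card_image; force simp: inj_on_def sum_list_sum_nth atLeast0LessThan)+
  ultimately show ?thesis
    by (simp add: card_Un_disjoint)
qed

text \<open>The star is laid out on the naturals with its centre at \<open>p\<close>: one arm runs
  upwards, the other downwards to 0. The number of vertices then gives the length of the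
  path.\<close>

lemma star_path_value:
  assumes "nonzeros (mset A) + nonzeros (mset B) \<le> 2"
  shows "induced_value (bistar_edges 0) (bistar_verts A 0 B) = (sum_list A + sum_list B + 1) mod 3"
proof -
  define len where "len = (\<lambda>(s, i). if s then (if i < length A then A ! i else 0)
    else if i < length B then B ! i else 0)"
  define K where "K = Pair True ` {i. i < length A \<and> A ! i \<noteq> 0} \<union> Pair False ` {i. i < length B \<and> B ! i \<noteq> 0}"
  have "card K \<le> 2"
  proof -
    have "card K \<le> card (Pair True ` {i. i < length A \<and> A ! i \<noteq> 0}) + card (Pair False ` {i. i < length B \<and> B ! i \<noteq> 0})"
      unfolding K_def by (rule card_Un_le)
    also have "\<dots> = nonzeros (mset A) + nonzeros (mset B)"
      unfolding nonzeros_mset by (simp add: card_image inj_on_def)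
    finally show ?thesis using assms by simp
  qed
  moreover have "finite K" by (simp add: K_def)
  ultimately have "card K = 0 \<and> finite K \<or> card K = 1 \<or> card K = 2"
    by linarith
  \<comment> \<open>Arms are labelled by side and index. If fewer than two are present, labels
    outside \<open>K\<close> fill up; their \<open>len\<close> is 0.\<close>
  then obtain a b where ab: "a \<noteq> b" "K \<subseteq> {a, b}"
  proof (elim disjE)
    assume "card K = 0 \<and> finite K"
    then show thesis by (intro that[of "(True, 0)" "(False, 0)"]) auto
  next
    assume "card K = 1"
    then obtain x where "K = {x}" by (rule card_1_singletonE)
    then show thesis by (intro that[of x "(\<not> fst x, 0)"]) (cases x, auto)
  next
    assume "card K = 2"
    then obtain x y where "K = {x, y}" "x \<noteq> y" by (auto simp: card_2_iff)
    then show thesis using that[of x y] by simp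
  qed
  define p where "p = len b"
  define arm where "arm = (\<lambda>(s, i) j. if s then LeftStar (Arm i j) else RightStar (Arm i j))"
  have arm_simps: "arm x j = arm y k \<longleftrightarrow> x = y \<and> j = k" "arm x j \<noteq> LeftStar Centre"
    "bistar_parent 0 (arm x j) = (if j \<le> 1 then LeftStar Centre else arm x (j - 1))"
    "in_bistar A 0 B (arm x j) \<longleftrightarrow> 1 \<le> j \<and> j \<le> len x" for x y :: "bool \<times> nat" and j k
    by (cases x; cases y; auto simp: arm_def len_def)+
  define f where "f = (\<lambda>v. case v of LeftStar (Arm i j) \<Rightarrow> if (True, i) = a then p + j else p - j
    | RightStar (Arm i j) \<Rightarrow> if (False, i) = a then p + j else p - j | _ \<Rightarrow> p)"
  have f_centre: "f (LeftStar Centre) = p"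
    by (simp add: f_def)
  have f_arm: "f (arm x j) = (if x = a then p + j else p - j)" for x j
    by (cases x) (auto simp: f_def arm_def)
  have vertex: "v = LeftStar Centre \<or> (\<exists>j. v = arm a j \<and> 1 \<le> j \<and> j \<le> len a) \<or>
      (\<exists>j. v = arm b j \<and> 1 \<le> j \<and> j \<le> p)" if "in_bistar A 0 B v" for v
  proof -
    have "v = LeftStar Centre \<or> (\<exists>x j. v = arm x j)"
      using that by (cases v rule: bistar_vertex_exhaust) (auto simp: arm_def split: if_splits)
    moreover have "x \<in> K" if "1 \<le> len x" for x
      using that by (cases x) (auto simp: K_def len_def split: if_splits)
    ultimately show ?thesis
      using that ab(2) unfolding p_def by (metis arm_simps(4) insertE le_trans singletonD subsetD)
  qed
  have inj: "inj_on f (bistar_verts A 0 B)"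
  proof (rule inj_onI)
    fix x y assume "x \<in> bistar_verts A 0 B" "y \<in> bistar_verts A 0 B" "f x = f y"
    then show "x = y"
      using vertex[of x] vertex[of y] ab(1) by (auto simp: f_arm f_centre arm_simps)
  qed
  have img: "f ` bistar_verts A 0 B = {0..<p + len a + 1}"
  proof (intro equalityI subsetI)
    fix n assume "n \<in> f ` bistar_verts A 0 B"
    then obtain v where v: "in_bistar A 0 B v" "n = f v" by auto
    from vertex[OF v(1)] have "f v < p + len a + 1"
      using ab(1) by (elim disjE exE conjE) (simp_all add: f_arm f_centre)
    then show "n \<in> {0..<p + len a + 1}"
      using v by simp
  next
    fix n assume n: "n \<in> {0..<p + len a + 1}"
    consider "n = p" | "p < n" | "n < p" by linarith
    then show "n \<in> f ` bistar_verts A 0 B"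
    proof cases
      case 1
      then show ?thesis by (intro image_eqI[of _ _ "LeftStar Centre"]) (auto simp: f_centre)
    next
      case 2
      then show ?thesis
        using n by (intro image_eqI[of _ _ "arm a (n - p)"]) (auto simp: f_arm arm_simps)
    next
      case 3
      then show ?thesis
        using ab(1) by (intro image_eqI[of _ _ "arm b (p - n)"]) (auto simp: f_arm arm_simps p_def)
    qed
  qed
  have edge: "(f x, f y) \<in> path_edges \<longleftrightarrow> (x, y) \<in> bistar_edges 0"
    if "x \<in> bistar_verts A 0 B" "y \<in> bistar_verts A 0 B" for x y
  proof -
    have ne: "LeftStar Centre \<noteq> arm z j" for z j
      using arm_simps(2) by metis
    have "in_bistar A 0 B x" "in_bistar A 0 B y"
      using that by simp_all
    from vertex[OF this(1)] vertex[OF this(2)] ab(1) show ?thesis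
      by (elim disjE exE conjE) (auto simp: f_arm f_centre arm_simps ne tree_edges_def split: if_splits)
  qed
  have "induced_value (bistar_edges 0) (bistar_verts A 0 B) = induced_value path_edges (f ` bistar_verts A 0 B)"
    using inj edge by (intro induced_value_iso[symmetric] sym_tree_edges connected_bistar_verts) auto
  also have "\<dots> = card (f ` bistar_verts A 0 B) mod 3"
    unfolding img path_value by simp
  also have "\<dots> = (sum_list A + sum_list B + 1) mod 3"
    by (simp add: card_image[OF inj] card_star_verts)
  finally show ?thesis .
qed

text \<open>Exchanging the sides moves the root to the other centre and reverses the link, which
  sends index \<open>i\<close> to \<open>m - i\<close>.\<close>

lemma bistar_swap_value:
  assumes "0 < m"
  shows "induced_value (bistar_edges m) (bistar_verts A m B) = induced_value (bistar_edges m) (bistar_verts B m A)"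
proof -
  define f where "f = (\<lambda>v. case v of LeftStar x \<Rightarrow> RightStar x | RightStar x \<Rightarrow> LeftStar x | Link i \<Rightarrow> Link (m - i))"
  have inj: "inj_on f (bistar_verts A m B)"
  proof (rule inj_onI, simp)
    fix x y assume "in_bistar A m B x" "in_bistar A m B y" "f x = f y"
    then show "x = y"
      by (cases x rule: bistar_vertex_exhaust; cases y rule: bistar_vertex_exhaust) (auto simp: f_def)
  qed
  have maps: "in_bistar B m A (f x)" "f (f x) = x" if "in_bistar A m B x" for x A B
    using that assms by (cases x rule: bistar_vertex_exhaust; auto simp: f_def)+
  have img: "f ` bistar_verts A m B = bistar_verts B m A"
  proof (intro equalityI subsetI)
    fix x assume "x \<in> bistar_verts B m A"
    then show "x \<in> f ` bistar_verts A m B"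
      using maps[of B A x] by (intro image_eqI[of _ _ "f x"]) auto
  qed (auto simp: maps)
  have edge: "(f x, f y) \<in> bistar_edges m \<longleftrightarrow> (x, y) \<in> bistar_edges m"
    if "x \<in> bistar_verts A m B" "y \<in> bistar_verts A m B" for x y
    using that assms
    by (cases x rule: bistar_vertex_exhaust; cases y rule: bistar_vertex_exhaust)
      (auto simp: f_def tree_edges_def)
  have "induced_value (bistar_edges m) (bistar_verts A m B) = induced_value (bistar_edges m) (f ` bistar_verts A m B)"
    using inj edge by (intro induced_value_iso[symmetric] sym_tree_edges connected_bistar_verts) auto
  then show ?thesis by (simp add: img)
qed

text \<open>The right centre becomes the root, and each vertex on its left is numbered by its
  distance from it: \<open>m - i\<close> on the link, \<open>m\<close> for the left centre,
  \<open>m + j\<close> on the left arm.\<close>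

lemma bistar_merge_value:
  assumes "0 < m" "nonzeros (mset A) \<le> 1"
  shows "induced_value (bistar_edges m) (bistar_verts A m B) =
    induced_value (bistar_edges 0) (bistar_verts [sum_list A + m] 0 B)"
proof -
  define f where "f = (\<lambda>v. case v of
      LeftStar Centre \<Rightarrow> LeftStar (Arm 0 m) | LeftStar (Arm i j) \<Rightarrow> LeftStar (Arm 0 (m + j))
    | Link i \<Rightarrow> LeftStar (Arm 0 (m - i))
    | RightStar Centre \<Rightarrow> LeftStar Centre | RightStar (Arm i j) \<Rightarrow> RightStar (Arm i j))"
  \<comment> \<open>\<open>k\<close> is the position of the only arm on the left; if there is none,
    it is arbitrary.\<close>
  have "\<exists>k. \<forall>i<length A. i \<noteq> k \<longrightarrow> A ! i = 0"
  proof -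
    have "i = k" if "i < length A" "A ! i \<noteq> 0" "k < length A" "A ! k \<noteq> 0" for i k
      using that assms(2) unfolding nonzeros_mset by (simp add: card_le_Suc0_iff_eq)
    then show ?thesis by metis
  qed
  then obtain k where k: "\<And>i. i < length A \<Longrightarrow> i \<noteq> k \<Longrightarrow> A ! i = 0" by blast
  have "sum_list A = (\<Sum>i<length A. if i = k then A ! k else 0)"
    unfolding sum_list_sum_nth atLeast0LessThan using k by (intro sum.cong) auto
  then have sumA: "sum_list A = (if k < length A then A ! k else 0)"
    by simp
  have vertex: "v = LeftStar Centre \<or> (\<exists>j. v = LeftStar (Arm k j) \<and> 1 \<le> j \<and> j \<le> sum_list A) \<or>
      (\<exists>i. v = Link i \<and> 1 \<le> i \<and> i < m) \<or> v = RightStar Centre \<or>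
      (\<exists>i j. v = RightStar (Arm i j) \<and> i < length B \<and> 1 \<le> j \<and> j \<le> B ! i)" if "in_bistar A m B v" for v
  proof (cases v rule: bistar_vertex_exhaust)
    case (2 i j)
    with that k[of i] sumA show ?thesis by (cases "i = k") auto
  qed (use that in auto)
  have inj: "inj_on f (bistar_verts A m B)"
  proof (rule inj_onI)
    fix x y assume "x \<in> bistar_verts A m B" "y \<in> bistar_verts A m B" "f x = f y"
    then show "x = y"
      using vertex[of x] vertex[of y] by (auto simp: f_def)
  qed
  have img: "f ` bistar_verts A m B = bistar_verts [sum_list A + m] 0 B"
  proof (intro equalityI subsetI)
    fix w assume "w \<in> f ` bistar_verts A m B"
    then obtain v where "in_bistar A m B v" "w = f v" by auto
    then show "w \<in> bistar_verts [sum_list A + m] 0 B"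
      using assms(1) vertex[of v] by (auto simp: f_def)
  next
    fix w assume w: "w \<in> bistar_verts [sum_list A + m] 0 B"
    have "\<exists>v. in_bistar A m B v \<and> w = f v"
    proof (cases w rule: bistar_vertex_exhaust)
      case 1
      then show ?thesis using assms(1) by (intro exI[of _ "RightStar Centre"]) (auto simp: f_def)
    next
      case (2 i j)
      then have j: "i = 0" "1 \<le> j" "j \<le> sum_list A + m" using w by auto
      consider "j < m" | "j = m" | "m < j" by linarith
      then show ?thesis
      proof cases
        case 1
        then show ?thesis using 2 j by (intro exI[of _ "Link (m - j)"]) (auto simp: f_def)
      next
        case 2
        then show ?thesis using \<open>w = LeftStar (Arm i j)\<close> j
          by (intro exI[of _ "LeftStar Centre"]) (auto simp: f_def)
      next
        case 3
        then have "k < length A" "j - m \<le> A ! k"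
          using j sumA by (auto split: if_splits)
        then show ?thesis using 2 3 j by (intro exI[of _ "LeftStar (Arm k (j - m))"]) (auto simp: f_def)
      qed
    next
      case (5 i j)
      then show ?thesis using w by (intro exI[of _ w]) (auto simp: f_def)
    qed (use w in auto)
    then show "w \<in> f ` bistar_verts A m B" by auto
  qed
  have edge: "(f x, f y) \<in> bistar_edges 0 \<longleftrightarrow> (x, y) \<in> bistar_edges m"
    if "x \<in> bistar_verts A m B" "y \<in> bistar_verts A m B" for x y
  proof -
    have "in_bistar A m B x" "in_bistar A m B y"
      using that by simp_all
    from vertex[OF this(1)] vertex[OF this(2)] assms(1) show ?thesis
      by (elim disjE exE conjE) (auto simp: f_def tree_edges_def)
  qed
  have "induced_value (bistar_edges m) (bistar_verts A m B) = induced_value (bistar_edges 0) (f ` bistar_verts A m B)"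
    using inj edge by (intro induced_value_iso[symmetric] sym_tree_edges connected_bistar_verts) auto
  then show ?thesis by (simp add: img)
qed

section \<open>Agreement of the game with the recursions on arm lengths\<close>

lemma induced_value_bistar_mex:
  assumes "if m = 0 then 3 \<le> nonzeros (mset A) + nonzeros (mset B)
    else 2 \<le> nonzeros (mset A) \<and> 2 \<le> nonzeros (mset B)"
    and "\<And>A'. A' \<in> shortenings A \<Longrightarrow>
      induced_value (bistar_edges m) (bistar_verts A' m B) = bistar_value (mset A') m (mset B)"
    and "\<And>B'. B' \<in> shortenings B \<Longrightarrow>
      induced_value (bistar_edges m) (bistar_verts A m B') = bistar_value (mset A) m (mset B')"
  shows "induced_value (bistar_edges m) (bistar_verts A m B) =
    mex (bistar_option_values (mset A) m (mset B))"
proof -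
  have "induced_value (bistar_edges m) ` deletions (bistar_edges m) (bistar_verts A m B) =
    (\<lambda>A'. bistar_value (mset A') m (mset B)) ` shortenings A \<union>
    (\<lambda>B'. bistar_value (mset A) m (mset B')) ` shortenings B"
    unfolding deletions_bistar[OF assms(1)] image_Un image_image
    using assms(2,3) by (intro arg_cong2[of _ _ _ _ "(\<union>)"] image_cong) auto
  also have "\<dots> = bistar_option_values (mset A) m (mset B)"
    unfolding bistar_option_values_def mset_shortenings[symmetric] image_image ..
  finally show ?thesis
    by (simp add: induced_value_mex sym_tree_edges connected_bistar_verts)
qed

lemma sum_list_shortenings: "A' \<in> shortenings A \<Longrightarrow> sum_list A' < sum_list A"
  using mset_shortenings[of A] arm_moves_sum[of "mset A'" "mset A"] by (auto simp: sum_mset_sum_list)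

text \<open>Comes before the general case because degenerate bistars are evaluated as stars. The
  arms are split over two lists, which is a bistar with \<open>m = 0\<close>.\<close>

lemma induced_value_star:
  "induced_value (bistar_edges 0) (bistar_verts A 0 B) = star_value (mset A + mset B)"
proof (induction "sum_list A + sum_list B" arbitrary: A B rule: less_induct)
  case less
  show ?case
  proof (cases "nonzeros (mset A) + nonzeros (mset B) \<le> 2")
    case True
    then show ?thesis
      by (simp add: star_path_value star_value_path sum_mset_sum_list)
  next
    case False
    then have "induced_value (bistar_edges 0) (bistar_verts A 0 B) = mex (bistar_option_values (mset A) 0 (mset B))"
      using less sum_list_shortenings by (intro induced_value_bistar_mex) (auto simp: bistar_value_0)
    also have "bistar_option_values (mset A) 0 (mset B) = star_value ` arm_moves (mset A + mset B)"
      unfolding bistar_option_values_def arm_moves_union image_Un image_image bistar_value_0 ..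
    also have "mex \<dots> = star_value (mset A + mset B)"
      using False star_value.simps[of "mset A + mset B"] by simp
    finally show ?thesis .
  qed
qed

theorem induced_value_bistar:
  "induced_value (bistar_edges m) (bistar_verts A m B) = bistar_value (mset A) m (mset B)"
proof (induction "sum_list A + sum_list B" arbitrary: A B rule: less_induct)
  case less
  have small: "induced_value (bistar_edges m) (bistar_verts A m B) = bistar_value (mset A) m (mset B)"
    if "0 < m" "nonzeros (mset A) \<le> 1" for A B
    using that by (simp add: bistar_merge_value induced_value_star bistar_value_left sum_mset_sum_list)
  consider "m = 0" | "0 < m" "nonzeros (mset A) \<le> 1" | "0 < m" "nonzeros (mset B) \<le> 1"
    | "0 < m" "1 < nonzeros (mset A)" "1 < nonzeros (mset B)"
    by linarith
  then show ?case
  proof cases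
    case 1
    then show ?thesis by (simp add: induced_value_star bistar_value_0)
  next
    case 2
    then show ?thesis by (rule small)
  next
    case 3
    then show ?thesis
      using small[of B A] bistar_swap_value[of m A B] by (simp add: bistar_value_commute[of "mset A"])
  next
    case 4
    then have "induced_value (bistar_edges m) (bistar_verts A m B) = mex (bistar_option_values (mset A) m (mset B))"
      using less sum_list_shortenings by (intro induced_value_bistar_mex) auto
    with 4 show ?thesis by (simp add: bistar_value_mex)
  qed
qed

theorem theorem4:
  fixes ls ls' :: "nat list" and m :: nat
  assumes "\<forall>l \<in> set ls. l \<ge> 1"
    and "\<forall>l \<in> set ls'. l \<ge> 1"
  shows "grundy_033 (with_proj
           (subdivided_bistar (subdivided_star ls) m (subdivided_star ls')))
       = grundy_033 (with_proj
           (subdivided_bistar (subdivided_star (map (\<lambda>l. l mod 3) ls)) (m mod 3)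
             (subdivided_star (map (\<lambda>l. l mod 3) ls'))))"
proof -
  have "grundy_033 (with_proj (subdivided_bistar (subdivided_star A) m (subdivided_star B)))
      = bistar_value (mset A) m (mset B)" for A B and m :: nat
    by (simp add: subdivided_bistar_eq induced_value_bistar flip: induced_value_def)
  then show ?thesis
    by (simp add: bistar_value_residues[of "mset ls" m "mset ls'"])
qed

end
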